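(* Let $X$ be any compact metric space and let $\lambda\in(0,1)$. We have \[\frac{\dim X}{2\log\frac1\lambda}\leqslant\mathrm{crit}_{\mathscr{I}_2}\,\mathrm{HC}(X;(\lambda^n))\leqslant\overline{\mathrm{M}}\text{-}\mathrm{crit}_{\mathscr{I}_2}\,\mathrm{HC}(X;(\lambda^n))\leqslant\frac{\overline{\mathrm{M}}\text{-}\dim X}{2\log\frac1\lambda}.\] In particular, if $X$ has positive and finite Hausdorff and upper Minkowski dimension, then \[\mathrm{crit}_{\mathscr{I}}\,\mathrm{HC}(X;(\lambda^n))=2.\]
   Context: For $f:[0,T)\to[0,+\infty)$ continuous non-decreasing with $f(0)=0$ and a subset $A$ of a Polish metric space, let $\Lambda_f(A)=\lim_{\delta\to0}\inf\big\{\sum_{i=1}^\infty f(\operatorname{diam}E_i): A\subset\bigcup_iE_i,\ \operatorname{diam}E_i\le\delta,\ E_i\text{ closed}\big\}$. For a family $\mathscr{F}=(f_s)_{s\in J}$ of such functions, $J\subset\mathbb R$ an interval, put $\mathrm{crit}_{\mathscr F}A=\sup\{s\in J:\Lambda_{f_s}(A)>0\}=\inf\{s\in J:\Lambda_{f_s}(A)=0\}$, and, for $A$ compact, $\overline{\mathrm{M}}\text{-}\mathrm{crit}_{\mathscr F}A=\inf\{s\in J:\limsup_{\varepsilon\to0}N(A,\varepsilon)f_s(\varepsilon)<+\infty\}$, where $N(A,\varepsilon)$ is the minimal number of balls of radius $\varepsilon$ needed to cover $A$ (conventions $\sup\emptyset=\inf J$, $\inf\emptyset=\sup J$). The coarse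 intermediate scale is $\mathscr{I}=\big(r\mapsto e^{-(\log\frac1r)^s}\big)_{s\in[1,+\infty)}$ and the fine intermediate scale is $\mathscr{I}_2=\big(r\mapsto e^{-s(\log\frac1r)^2}\big)_{s\in(0,+\infty)}$ (functions of small $r>0$, with value $0$ at $0$). $\dim X$ is the Hausdorff dimension and $\overline{\mathrm{M}}\text{-}\dim X=\limsup_{\varepsilon\to0}\frac{\log N(X,\varepsilon)}{\log(1/\varepsilon)}$ the upper Minkowski dimension. For a compact metric space $(X,d)$ and an $\ell^2$ sequence $\bar a=(a_n)_{n\ge1}$ of positive reals, $\mathrm{HC}(X;\bar a)$ is the set $X^{\mathbb N}$ of sequences $\bar x=(x_n)_{n\ge1}$ with the metric $d_{\bar a}(\bar x,\bar y)=\big(\sum_{n=1}^\infty a_n^2d(x_n,y_n)^2\big)^{1/2}$. *)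

theory Defs
  imports "HOL-Analysis.Analysis"
begin

definition set_diam :: "('a \<Rightarrow> 'a \<Rightarrow> real) \<Rightarrow> 'a set \<Rightarrow> ennreal" where
  "set_diam d E = (SUP (x, y) \<in> E \<times> E. ennreal (d x y))"

(* The gauge f is a total function here, but only its values on [0, \<delta>] for small \<delta> matter,
   so nothing depends on how it is extended beyond its natural domain [0, T). *)
definition Lambda :: "'a set \<Rightarrow> ('a \<Rightarrow> 'a \<Rightarrow> real) \<Rightarrow> (real \<Rightarrow> real) \<Rightarrow> 'a set \<Rightarrow> ennreal" where
  "Lambda M d f A =
     Lim (at_right 0) (\<lambda>\<delta>::real.
       INF E \<in> {E :: nat \<Rightarrow> 'a set. A \<subseteq> (\<Union>i. E i) \<and>
                 (\<forall>i. set_diam d (E i) \<le> ennreal \<delta> \<and>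
                      closedin (Metric_space.mtopology M d) (E i))}.
         \<Sum>i. ennreal (f (enn2real (set_diam d (E i)))))"

(* A family of gauges together with its index set J. *)
type_synonym gauge_family = "real set \<times> (real \<Rightarrow> real \<Rightarrow> real)"

(* sup {} = inf J by convention, whereas Sup {} = -\<infinity> in ereal. *)
definition crit :: "'a set \<Rightarrow> ('a \<Rightarrow> 'a \<Rightarrow> real) \<Rightarrow> gauge_family \<Rightarrow> 'a set \<Rightarrow> ereal" where
  "crit M d F A =
     (let J = fst F; f = snd F; S = {s \<in> J. Lambda M d (f s) A > 0}
      in if S = {} then Inf (ereal ` J) else Sup (ereal ` S))"

(* Number of open balls with centres in M; intended for A compact and \<epsilon> > 0, where finite covers
   exist. *)
definition cover_num :: "'a set \<Rightarrow> ('a \<Rightarrow> 'a \<Rightarrow> real) \<Rightarrow> 'a set \<Rightarrow> real \<Rightarrow> nat" where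
  "cover_num M d A \<epsilon> =
     (LEAST n. \<exists>C. finite C \<and> C \<subseteq> M \<and> card C = n \<and> A \<subseteq> (\<Union>x\<in>C. Metric_space.mball M d x \<epsilon>))"

definition upper_Minkowski_crit ::
    "'a set \<Rightarrow> ('a \<Rightarrow> 'a \<Rightarrow> real) \<Rightarrow> gauge_family \<Rightarrow> 'a set \<Rightarrow> ereal" where
  "upper_Minkowski_crit M d F A =
     (let J = fst F; f = snd F;
          S = {s \<in> J. Limsup (at_right 0) (\<lambda>\<epsilon>. ereal (real (cover_num M d A \<epsilon>) * f s \<epsilon>)) < \<infinity>}
      in if S = {} then Sup (ereal ` J) else Inf (ereal ` S))"

definition coarse_scale :: gauge_family where
  "coarse_scale = ({1..}, \<lambda>s r. if r = 0 then 0 else exp (- (ln (1 / r) powr s)))"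

definition fine_scale :: gauge_family where
  "fine_scale = ({0<..}, \<lambda>s r. if r = 0 then 0 else exp (- (s * (ln (1 / r))\<^sup>2)))"

(* For the gauge r^s, Lambda is the s-dimensional Hausdorff measure (restricting to closed covering
   sets is harmless, as closures have the same diameter); crit is then the usual threshold, with
   value 0 if no positive exponent has positive measure. *)
definition Hausdorff_dim :: "'a set \<Rightarrow> ('a \<Rightarrow> 'a \<Rightarrow> real) \<Rightarrow> 'a set \<Rightarrow> ereal" where
  "Hausdorff_dim M d A = crit M d ({0<..}, \<lambda>s r. r powr s) A"

(* As ln 0 = 0, the empty set gets dimension 0. *)
definition upper_Minkowski_dim :: "'a set \<Rightarrow> ('a \<Rightarrow> 'a \<Rightarrow> real) \<Rightarrow> 'a set \<Rightarrow> ereal" where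
  "upper_Minkowski_dim M d A =
     Limsup (at_right 0) (\<lambda>\<epsilon>. ereal (ln (real (cover_num M d A \<epsilon>)) / ln (1 / \<epsilon>)))"

definition HC :: "'a set \<Rightarrow> (nat \<Rightarrow> 'a) set" where
  "HC X = {1..} \<rightarrow>\<^sub>E X"

(* infsum rather than suminf: the locale Metric_space asks for nonnegativity also outside the
   carrier, and infsum (unlike suminf) is 0 on non-summable families. *)
definition HC_dist ::
    "('a \<Rightarrow> 'a \<Rightarrow> real) \<Rightarrow> (nat \<Rightarrow> real) \<Rightarrow> (nat \<Rightarrow> 'a) \<Rightarrow> (nat \<Rightarrow> 'a) \<Rightarrow> real" where
  "HC_dist d a x y = sqrt (\<Sum>\<^sub>\<infinity>n\<in>{1..}. (a n)\<^sup>2 * (d (x n) (y n))\<^sup>2)"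

lemma Metric_space_HC:
  assumes "Metric_space X d" "compact_space (Metric_space.mtopology X d)"
    and a: "\<And>n. n \<ge> 1 \<Longrightarrow> a n > 0" "(\<lambda>n. (a n)\<^sup>2) summable_on {1..}"
  shows "Metric_space (HC X) (HC_dist d a)"
proof -
  interpret Metric_space X d by fact
  have "mbounded X"
    using assms(2) compactin_imp_mbounded by (auto simp: compact_space_def)
  then obtain B where B: "\<And>x y. x \<in> X \<Longrightarrow> y \<in> X \<Longrightarrow> d x y \<le> B"
    unfolding mbounded_alt by blast
  have summ: "(\<lambda>n. (a n)\<^sup>2 * (d (x n) (y n))\<^sup>2) summable_on {1..}"
    if "x \<in> HC X" "y \<in> HC X" for x y
  proof (rule summable_on_comparison_test)
    show "(\<lambda>n. (a n)\<^sup>2 * B\<^sup>2) summable_on {1..}"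
      by (rule summable_on_cmult_left) (rule a)
    fix n :: nat assume n: "n \<in> {1..}"
    then have "d (x n) (y n) \<le> B" using that B by (auto simp: HC_def PiE_iff)
    then show "(a n)\<^sup>2 * (d (x n) (y n))\<^sup>2 \<le> (a n)\<^sup>2 * B\<^sup>2"
      by (intro mult_left_mono power_mono) auto
  qed auto
  define L where "L = (\<lambda>F x y. L2_set (\<lambda>n. a n * d (x n) (y n)) F)"
  have lim: "((\<lambda>F. L F x y) \<longlongrightarrow> HC_dist d a x y) (finite_subsets_at_top {1..})"
    if "x \<in> HC X" "y \<in> HC X" for x y
    using infsum_tendsto[OF summ[OF that]]
    unfolding HC_dist_def L_def L2_set_def power_mult_distrib by (rule tendsto_real_sqrt)
  show ?thesis
  proof
    fix x y :: "nat \<Rightarrow> 'a"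
    show "0 \<le> HC_dist d a x y" by (auto simp: HC_dist_def intro!: infsum_nonneg)
    show "HC_dist d a x y = HC_dist d a y x" by (simp add: HC_dist_def commute)
  next
    fix x y assume xy: "x \<in> HC X" "y \<in> HC X"
    show "HC_dist d a x y = 0 \<longleftrightarrow> x = y"
    proof
      assume "HC_dist d a x y = 0"
      then have *: "(\<Sum>\<^sub>\<infinity>n\<in>{1..}. (a n)\<^sup>2 * (d (x n) (y n))\<^sup>2) = 0"
        by (simp add: HC_dist_def)
      have "x n = y n" if n: "n \<in> {1..}" for n
      proof -
        have "(a n)\<^sup>2 * (d (x n) (y n))\<^sup>2 = 0"
          by (rule nonneg_infsum_le_0D[OF _ summ[OF xy] _ n]) (use * in auto)
        moreover have "x n \<in> X" "y n \<in> X" using xy n by (auto simp: HC_def PiE_iff)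
        moreover have "a n > 0" using a n by auto
        ultimately show ?thesis by simp
      qed
      then show "x = y" using PiE_ext[of x "{1..}" "\<lambda>_. X" y] xy unfolding HC_def by blast
    next
      assume "x = y"
      have "(\<Sum>\<^sub>\<infinity>n\<in>{1..}. (a n)\<^sup>2 * (d (x n) (y n))\<^sup>2) = (\<Sum>\<^sub>\<infinity>n\<in>{1::nat..}. 0)"
        by (rule infsum_cong) (use xy \<open>x = y\<close> in \<open>auto simp: HC_def PiE_iff\<close>)
      then show "HC_dist d a x y = 0" by (simp add: HC_dist_def)
    qed
  next
    fix x y z assume xyz: "x \<in> HC X" "y \<in> HC X" "z \<in> HC X"
    have "L F x z \<le> L F x y + L F y z" if F: "F \<subseteq> {1..}" for F
    proof -
      have "L F x z \<le> L2_set (\<lambda>n. a n * d (x n) (y n) + a n * d (y n) (z n)) F"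
        unfolding L_def
      proof (rule L2_set_mono)
        fix n assume "n \<in> F"
        then have n: "n \<in> {1..}" using F by auto
        have "d (x n) (z n) \<le> d (x n) (y n) + d (y n) (z n)"
          using xyz n by (intro triangle) (auto simp: HC_def PiE_iff)
        moreover have "0 \<le> a n" using a(1)[of n] n by auto
        ultimately have "a n * d (x n) (z n) \<le> a n * (d (x n) (y n) + d (y n) (z n))"
          by (rule mult_left_mono)
        then show "a n * d (x n) (z n) \<le> a n * d (x n) (y n) + a n * d (y n) (z n)"
          by (simp add: distrib_left)
        show "0 \<le> a n * d (x n) (z n)" using \<open>0 \<le> a n\<close> by simp
      qed
      also have "\<dots> \<le> L F x y + L F y z" unfolding L_def by (rule L2_set_triangle_ineq)
      finally show ?thesis .
    qed
    then have ev: "\<forall>\<^sub>F F in finite_subsets_at_top {1..}. L F x z \<le> L F x y + L F y z"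
      by (auto intro: eventually_finite_subsets_at_top_weakI)
    show "HC_dist d a x z \<le> HC_dist d a x y + HC_dist d a y z"
      by (rule tendsto_le[OF _ tendsto_add[OF lim lim] lim ev]) (use xyz in auto)
  qed
qed

lemma Lambda_eq_SUP:
  "Lambda M d f A =
     (SUP \<delta>\<in>{0<..}. INF E \<in> {E :: nat \<Rightarrow> 'a set. A \<subseteq> (\<Union>i. E i) \<and>
                 (\<forall>i. set_diam d (E i) \<le> ennreal \<delta> \<and>
                      closedin (Metric_space.mtopology M d) (E i))}.
         \<Sum>i. ennreal (f (enn2real (set_diam d (E i)))))" (is "_ = (SUP \<delta>\<in>_. ?g \<delta>)")
proof -
  have anti: "?g \<delta>' \<le> ?g \<delta>" if "\<delta> \<le> \<delta>'" for \<delta> \<delta>' :: real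
    by (rule INF_superset_mono) (use that ennreal_leI order_trans in blast, simp)
  have "(?g \<longlongrightarrow> (SUP \<delta>\<in>{0<..}. ?g \<delta>)) (at_right 0)"
  proof (rule order_tendstoI)
    fix u assume "u < (SUP \<delta>\<in>{0<..}. ?g \<delta>)"
    then obtain \<delta> where "\<delta> > 0" "u < ?g \<delta>" by (auto simp only: less_SUP_iff greaterThan_iff)
    then show "\<forall>\<^sub>F x in at_right 0. u < ?g x"
      using anti by (intro eventually_at_rightI[of 0 \<delta>]) (auto intro: less_le_trans)
  next
    fix u assume u: "(SUP \<delta>\<in>{0<..}. ?g \<delta>) < u"
    show "\<forall>\<^sub>F x in at_right 0. ?g x < u"
      by (rule eventually_at_rightI[of 0 1]) (auto intro: le_less_trans[OF _ u] SUP_upper)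
  qed
  then show ?thesis unfolding Lambda_def by (intro tendsto_Lim) auto
qed

lemma Lambda_mono:
  assumes "\<forall>\<^sub>F r in at_right 0. f r \<le> g r" "f 0 \<le> g 0"
  shows "Lambda M d f A \<le> Lambda M d g A"
proof -
  obtain b where b: "b > 0" "\<And>r. 0 < r \<Longrightarrow> r < b \<Longrightarrow> f r \<le> g r"
    using assms(1) by (auto simp: eventually_at_right_field)
  define C where "C \<delta> = {E :: nat \<Rightarrow> 'a set. A \<subseteq> (\<Union>i. E i) \<and>
                 (\<forall>i. set_diam d (E i) \<le> ennreal \<delta> \<and>
                      closedin (Metric_space.mtopology M d) (E i))}" for \<delta> :: real
  show ?thesis unfolding Lambda_eq_SUP C_def[symmetric]
  proof (rule SUP_mono)
    fix \<delta> :: real assume "\<delta> \<in> {0<..}"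
    define \<delta>' where "\<delta>' = min \<delta> (b/2)"
    have \<delta>': "\<delta>' > 0" "\<delta>' \<le> \<delta>" "\<delta>' < b" using b \<open>\<delta> \<in> _\<close> by (auto simp: \<delta>'_def)
    have "(INF E\<in>C \<delta>. \<Sum>i. ennreal (f (enn2real (set_diam d (E i)))))
          \<le> (INF E\<in>C \<delta>'. \<Sum>i. ennreal (g (enn2real (set_diam d (E i)))))"
    proof (rule INF_mono)
      fix E assume E: "E \<in> C \<delta>'"
      have "E \<in> C \<delta>" using E ennreal_leI[OF \<delta>'(2)] unfolding C_def by (blast intro: order_trans)
      moreover have "f (enn2real (set_diam d (E i))) \<le> g (enn2real (set_diam d (E i)))" for i
      proof -
        have "enn2real (set_diam d (E i)) \<le> \<delta>'"
          using E \<delta>' by (intro enn2real_leI) (auto simp: C_def)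
        then have "enn2real (set_diam d (E i)) < b" using \<delta>' by linarith
        then show ?thesis using b(2)[of "enn2real (set_diam d (E i))"] assms(2) enn2real_nonneg
          by (metis order_le_imp_less_or_eq)
      qed
      ultimately show "\<exists>E'\<in>C \<delta>. (\<Sum>i. ennreal (f (enn2real (set_diam d (E' i)))))
           \<le> (\<Sum>i. ennreal (g (enn2real (set_diam d (E i)))))"
        by (intro bexI[of _ E] suminf_le ennreal_leI) auto
    qed
    then show "\<exists>\<delta>'\<in>{0<..}. (INF E\<in>C \<delta>. \<Sum>i. ennreal (f (enn2real (set_diam d (E i)))))
          \<le> (INF E\<in>C \<delta>'. \<Sum>i. ennreal (g (enn2real (set_diam d (E i)))))"
      using \<delta>'(1) by (intro bexI[of _ \<delta>']) simp_all
  qed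
qed

(* The two expressions for the critical parameter agree for every family that is decreasing in the
   parameter near 0, in particular for the three families above. *)
lemma crit_eq_Inf:
  assumes J: "is_interval J" "J \<noteq> {}"
    and mono: "\<And>s t. s \<in> J \<Longrightarrow> t \<in> J \<Longrightarrow> s \<le> t \<Longrightarrow> f t 0 \<le> f s 0 \<and> (\<forall>\<^sub>F r in at_right 0. f t r \<le> f s r)"
  shows "crit M d (J, f) A =
     (let S = {s \<in> J. Lambda M d (f s) A = 0} in if S = {} then Sup (ereal ` J) else Inf (ereal ` S))"
proof -
  define P where "P = {s \<in> J. Lambda M d (f s) A > 0}"
  define Z where "Z = {s \<in> J. Lambda M d (f s) A = 0}"
  have PZ: "J = P \<union> Z" by (auto simp: P_def Z_def zero_less_iff_neq_zero)
  have less: "s < t" if "s \<in> P" "t \<in> Z" for s t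
  proof (rule ccontr)
    assume "\<not> s < t"
    then have "Lambda M d (f s) A \<le> Lambda M d (f t) A"
      using that mono[of t s] by (intro Lambda_mono) (auto simp: P_def Z_def)
    then show False using that by (auto simp: P_def Z_def)
  qed
  have "Sup (ereal ` P) = Inf (ereal ` Z)" if ne: "P \<noteq> {}" "Z \<noteq> {}"
  proof (rule antisym)
    show "Sup (ereal ` P) \<le> Inf (ereal ` Z)"
      by (intro Sup_least Inf_greatest) (auto dest: less)
    show "Inf (ereal ` Z) \<le> Sup (ereal ` P)"
    proof (rule ccontr)
      assume "\<not> ?thesis"
      then obtain c where c: "Sup (ereal ` P) < ereal c" "ereal c < Inf (ereal ` Z)"
        using ereal_dense2[of "Sup (ereal ` P)" "Inf (ereal ` Z)"] unfolding not_le by blast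
      obtain p z where pz: "p \<in> P" "z \<in> Z" using ne by auto
      have "ereal p < ereal c" using c(1) pz by (meson Sup_upper imageI le_less_trans)
      moreover have "ereal c < ereal z" using c(2) pz by (meson Inf_lower imageI less_le_trans)
      ultimately have "c \<in> J" using J(1) pz PZ less_imp_le
        unfolding is_interval_1 ereal_less_eq by (metis UnI1 UnI2 less_ereal.simps(1))
      then consider "c \<in> P" | "c \<in> Z" using PZ by auto
      then show False
      proof cases
        case 1 then show False using c(1) by (meson Sup_upper imageI leD)
      next
        case 2 then show False using c(2) by (meson Inf_lower imageI leD)
      qed
    qed
  qed
  then show ?thesis using PZ J(2)
    unfolding crit_def Let_def fst_conv snd_conv P_def[symmetric] Z_def[symmetric] by auto
qed

end

theory Submission
  imports Defs "HOL-Real_Asymp.Real_Asymp"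
begin

text \<open>
Write \<open>L = ln (1 / r)\<close> and \<open>l = ln (1 / lam)\<close>.  At scale \<open>r\<close> only the first
  \<open>L / l\<close> coordinates of the cube are visible, and the \<open>n\<close>-th of them is seen at the scale
  \<open>r / lam ^ n\<close>.  If the factor has dimension \<open>t\<close>, coordinate \<open>n\<close> contributes about
  \<open>(r / lam ^ n) powr t = exp (- t * (L - n * l))\<close>, and summing the exponents over
  \<open>n \<le> L / l\<close> gives \<open>exp (- t * L\<^sup>2 / (2 * l))\<close>.  Hence the fine gauge with parameter
  \<open>t / (2 * l)\<close> is the critical one; all errors made below are \<open>o(L\<^sup>2)\<close> in the exponent.

  For the upper bound, a net of the cube is a product of nets of the factor
  (\<open>HC_finite_cover\<close>), so covering numbers multiply and the computation above applies with the
  upper Minkowski dimension (\<open>HC_cover_num_fine_bounded\<close>).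

  For the lower bound the usual tool is a product of Frostman measures.  The proof here uses the
  dual notion and constructs no measure: a cover of the factor by sets \<open>E i\<close> carrying weights
  \<open>w i\<close>, such that each point has total weight at least \<open>1\<close>.  Three facts carry the
  argument.

  \<^item> Positive Hausdorff measure in dimension \<open>s\<close> bounds \<open>\<Sum>i. w i * b i powr t\<close> below, for
    \<open>t < s\<close> and sets of diameter at most \<open>b i\<close> (\<open>weighted_content_le\<close>).  The loss of
    exponent pays for choosing, at each point, one dyadic scale that carries a definite share of
    the weight.

  \<^item> With the truncated gauge \<open>m r = min 1 (C * r powr t)\<close> the lower bound becomes exactly
    \<open>1\<close> (\<open>truncated_gauge_weighted_cover\<close>).  This normalisation is what survives infinitely
    many factors, where a constant below \<open>1\<close> would be lost.

  \<^item> If a cover of the cube by sets of diameter \<open>r i\<close> had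
    \<open>(\<Sum>i. \<Prod>n\<ge>1. m (r i / lam ^ n)) < 1\<close>, one could choose the coordinates of a point one
    after the other, each time keeping the corresponding sum over the sets that still meet the
    chosen cylinder below \<open>1\<close>.  The limit point would lie in some set of the cover, for which
    the remaining factors are eventually all equal to \<open>1\<close>: a contradiction
    (\<open>HC_cover_sum_ge_1\<close>).

  The middle inequality is the standard comparison of covers by arbitrary sets with covers by
  balls of equal radius.  The coarse statement follows because \<open>exp (- L powr s)\<close> lies above
  every fine gauge for \<open>s < 2\<close> and below every fine gauge for \<open>s > 2\<close>.
\<close>

section \<open>Covers and Hausdorff content\<close>

lemma suminf_ennreal_swap:
  fixes f :: "nat \<Rightarrow> nat \<Rightarrow> ennreal"
  shows "(\<Sum>i. \<Sum>j. f i j) = (\<Sum>j. \<Sum>i. f i j)"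
proof -
  have "(\<Sum>i. \<Sum>j. f i j) = (\<Sum>i. \<integral>\<^sup>+j. f i j \<partial>count_space UNIV)"
    by (simp add: nn_integral_count_space_nat)
  also have "\<dots> = (\<integral>\<^sup>+j. (\<Sum>i. f i j) \<partial>count_space UNIV)"
    by (rule nn_integral_suminf[symmetric]) simp
  finally show ?thesis by (simp add: nn_integral_count_space_nat)
qed

lemma le_set_diam: "x \<in> E \<Longrightarrow> y \<in> E \<Longrightarrow> ennreal (d x y) \<le> set_diam d E"
  unfolding set_diam_def by (auto intro!: SUP_upper2[of "(x, y)"])

lemma set_diam_le: "(\<And>x y. x \<in> E \<Longrightarrow> y \<in> E \<Longrightarrow> d x y \<le> b) \<Longrightarrow> set_diam d E \<le> ennreal b"
  unfolding set_diam_def by (auto intro!: SUP_least ennreal_leI)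

lemma set_diam_empty [simp]: "set_diam d {} = 0"
  unfolding set_diam_def by (simp add: bot_ennreal)

text \<open>Membership of a diameter in a dyadic scale, with both inequalities needed: the first makes sets
of that scale small compared with the separation of a net, the second converts the radius of the
net back into the diameter.\<close>

lemma dyadic_scale:
  fixes b :: real
  assumes "0 < b" "b \<le> 1"
  obtains k where "b \<le> (1/2) ^ k" "(1/2) ^ k < 2 * b"
proof -
  obtain n where n: "(1/2::real) ^ n < b"
    using real_arch_pow_inv[of b "1/2"] assms by auto
  define m where "m = (LEAST n. (1/2::real) ^ n < b)"
  have m: "(1/2::real) ^ m < b" unfolding m_def using n by (rule LeastI)
  have "m \<noteq> 0"
  proof
    assume "m = 0" then show False using m assms by simp
  qed
  then obtain k where k: "m = Suc k" by (cases m) auto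
  have "\<not> (1/2::real) ^ k < b" using not_less_Least[of k "\<lambda>n. (1/2::real) ^ n < b"] k m_def by auto
  then show thesis using that[of k] m k by auto
qed

context Metric_space
begin

text \<open>The expression minimised in \<^const>\<open>Lambda\<close> at mesh \<open>\<delta>\<close>, tested on the closed balls of a finite
cover, padded by empty sets to a sequence.\<close>

lemma Lambda_le_card_cover:
  assumes C: "finite C" "C \<subseteq> M" "A \<subseteq> (\<Union>x\<in>C. mball x \<epsilon>)" and "0 < \<epsilon>" "2 * \<epsilon> \<le> \<delta>"
    and f: "f 0 = 0" "\<And>r. 0 \<le> r \<Longrightarrow> r \<le> 2 * \<epsilon> \<Longrightarrow> f r \<le> v"
  shows "(INF E \<in> {E :: nat \<Rightarrow> 'a set. A \<subseteq> (\<Union>i. E i) \<and>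
                 (\<forall>i. set_diam d (E i) \<le> ennreal \<delta> \<and> closedin mtopology (E i))}.
         \<Sum>i. ennreal (f (enn2real (set_diam d (E i))))) \<le> ennreal (real (card C) * v)"
proof -
  define n where "n = card C"
  obtain e where e: "bij_betw e {..<n} C"
    using ex_bij_betw_nat_finite[OF C(1)] by (auto simp: n_def atLeast0LessThan)
  define E where "E i = (if i < n then mcball (e i) \<epsilon> else {})" for i
  have diam: "set_diam d (E i) \<le> ennreal (2 * \<epsilon>)" for i
  proof (rule set_diam_le)
    fix x y assume "x \<in> E i" "y \<in> E i"
    then have "e i \<in> M" "x \<in> M" "y \<in> M" "d (e i) x \<le> \<epsilon>" "d (e i) y \<le> \<epsilon>"
      by (auto simp: E_def split: if_splits)
    then show "d x y \<le> 2 * \<epsilon>" using triangle[of x "e i" y] by (simp add: commute)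
  qed
  have "A \<subseteq> (\<Union>i. E i)"
  proof
    fix x assume "x \<in> A"
    then obtain c where "c \<in> C" "x \<in> mball c \<epsilon>" using C by auto
    moreover obtain i where "i < n" "e i = c" using e \<open>c \<in> C\<close> by (auto simp: bij_betw_def)
    ultimately show "x \<in> (\<Union>i. E i)" using mball_subset_mcball by (force simp: E_def)
  qed
  moreover have "set_diam d (E i) \<le> ennreal \<delta>" for i
    using diam[of i] assms(5) by (meson ennreal_leI order_trans)
  moreover have "closedin mtopology (E i)" for i by (simp add: E_def)
  ultimately have "E \<in> {E :: nat \<Rightarrow> 'a set. A \<subseteq> (\<Union>i. E i) \<and>
                 (\<forall>i. set_diam d (E i) \<le> ennreal \<delta> \<and> closedin mtopology (E i))}" by blast
  moreover have "(\<Sum>i. ennreal (f (enn2real (set_diam d (E i))))) \<le> ennreal (real n * v)"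
  proof -
    have v: "0 \<le> v" using f(2)[of 0] f(1) \<open>0 < \<epsilon>\<close> by simp
    have "(\<Sum>i. ennreal (f (enn2real (set_diam d (E i)))))
        = (\<Sum>i<n. ennreal (f (enn2real (set_diam d (E i)))))"
      by (rule suminf_finite) (auto simp: E_def f)
    also have "\<dots> \<le> (\<Sum>i<n. ennreal v)"
      using diam \<open>0 < \<epsilon>\<close> by (intro sum_mono ennreal_leI f(2) enn2real_leI) auto
    also have "\<dots> = ennreal (real n * v)" using v by (simp add: ennreal_mult ennreal_of_nat_eq_real_of_nat)
    finally show ?thesis .
  qed
  ultimately show ?thesis unfolding n_def by - (rule INF_lower2[of E])
qed

text \<open>A lower bound for the \<open>s\<close>-dimensional Hausdorff content. The numbers \<open>b i\<close> are upper bounds for the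
diameters, so that no diameter ever has to be computed.\<close>

definition content_ge :: "real \<Rightarrow> real \<Rightarrow> bool" where
  "content_ge s c \<longleftrightarrow>
     (\<forall>(E :: nat \<Rightarrow> 'a set) b. M \<subseteq> (\<Union>i. E i) \<longrightarrow>
        (\<forall>i. closedin mtopology (E i) \<and> 0 \<le> b i \<and> (\<forall>x\<in>E i. \<forall>y\<in>E i. d x y \<le> b i)) \<longrightarrow>
        ennreal c \<le> (\<Sum>i. ennreal (b i powr s)))"

text \<open>A fractional cover of \<^term>\<open>M\<close>. The sets are arbitrary subsets of the type, and the bounds
\<open>b i\<close> for the diameters of their traces on \<^term>\<open>M\<close> are positive, as \<open>0\<close> belongs to no dyadic scale.\<close>

definition weighted_cover :: "(nat \<Rightarrow> ennreal) \<Rightarrow> (nat \<Rightarrow> 'a set) \<Rightarrow> (nat \<Rightarrow> real) \<Rightarrow> real \<Rightarrow> bool" where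
  "weighted_cover w E b \<theta> \<longleftrightarrow>
     (\<forall>i. 0 < b i \<and> (\<forall>x\<in>E i \<inter> M. \<forall>y\<in>E i \<inter> M. d x y \<le> b i)) \<and>
     (\<forall>x\<in>M. ennreal \<theta> \<le> (\<Sum>i. w i * indicator (E i) x))"

text \<open>A cover with small sum \<open>\<Sum>i. b i powr s\<close> consists of small sets only, so no bound on the mesh has to be
imposed: if the sum is below \<open>\<delta> powr s\<close>, the cover is admissible for mesh \<open>\<delta>\<close>.\<close>

lemma Hausdorff_content_pos:
  assumes "Lambda M d (\<lambda>r. r powr s) M > 0" "0 < s"
  obtains c where "0 < c" "content_ge s c"
proof -
  define C where "C \<delta> = {E :: nat \<Rightarrow> 'a set. M \<subseteq> (\<Union>i. E i) \<and>
                 (\<forall>i. set_diam d (E i) \<le> ennreal \<delta> \<and> closedin mtopology (E i))}" for \<delta>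
  define I where "I \<delta> = (INF E \<in> C \<delta>. \<Sum>i. ennreal (enn2real (set_diam d (E i)) powr s))" for \<delta>
  have "0 < (SUP \<delta>\<in>{0<..}. I \<delta>)"
    using assms(1) unfolding Lambda_eq_SUP I_def C_def .
  then obtain \<delta> where \<delta>: "0 < \<delta>" "0 < I \<delta>" by (auto simp: less_SUP_iff)
  define c where "c = min (I \<delta>) (ennreal (\<delta> powr s))"
  have c0: "0 < c" "c \<le> ennreal (\<delta> powr s)" "c \<le> I \<delta>" using \<delta> by (auto simp: c_def)
  then have "c < top" by (meson ennreal_less_top le_less_trans)
  then obtain c' where c': "c = ennreal c'" "0 < c'"
    using c0 by (cases c) (auto simp: ennreal_less_zero_iff)
  have "c \<le> (\<Sum>i. ennreal (b i powr s))"
    if cov: "M \<subseteq> (\<Union>i::nat. E i)" and cl: "\<And>i. closedin mtopology (E i)" and b: "\<And>i. 0 \<le> b i"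
      and dia: "\<And>i x y. x \<in> E i \<Longrightarrow> y \<in> E i \<Longrightarrow> d x y \<le> b i" for E b
  proof (rule ccontr)
    assume *: "\<not> ?thesis"
    then have "(\<Sum>i. ennreal (b i powr s)) < ennreal (\<delta> powr s)" using c0 by auto
    then have "ennreal (b i powr s) < ennreal (\<delta> powr s)" for i by (rule ennreal_suminf_lessD)
    then have "b i powr s < \<delta> powr s" for i by (simp add: ennreal_less_iff)
    then have "\<not> \<delta> powr s \<le> b i powr s" for i by (simp add: not_le)
    then have lt: "b i < \<delta>" for i
      using powr_mono2[of s \<delta> "b i"] \<delta>(1) \<open>0 < s\<close> by force
    have diam: "set_diam d (E i) \<le> ennreal (b i)" for i using dia by (rule set_diam_le)
    have "set_diam d (E i) \<le> ennreal \<delta>" for i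
      using diam[of i] ennreal_leI[OF less_imp_le[OF lt[of i]]] by (rule order_trans)
    then have "E \<in> C \<delta>" unfolding C_def using cov cl by blast
    then have "I \<delta> \<le> (\<Sum>i. ennreal (enn2real (set_diam d (E i)) powr s))"
      unfolding I_def by (rule INF_lower)
    also have "\<dots> \<le> (\<Sum>i. ennreal (b i powr s))"
      using \<open>0 < s\<close> by (intro suminf_le ennreal_leI powr_mono2 enn2real_leI diam b) auto
    finally show False using * c0 by auto
  qed
  then have "content_ge s c'" unfolding content_ge_def c'(1) by blast
  then show thesis using that c'(2) by blast
qed

text \<open>A separated set has at most as many points as there are balls of half the radius in a finite
cover; a separated set of maximal cardinality is therefore available, and it is a net.\<close>

lemma maximal_separated_set:
  assumes "mtotally_bounded M" "A \<subseteq> M" "0 < r"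
  obtains Z where "finite Z" "Z \<subseteq> A" "\<And>x y. x \<in> Z \<Longrightarrow> y \<in> Z \<Longrightarrow> x \<noteq> y \<Longrightarrow> r < d x y"
    "A \<subseteq> (\<Union>z\<in>Z. mcball z r)"
proof -
  obtain K where K: "finite K" "K \<subseteq> M" "M \<subseteq> (\<Union>x\<in>K. mball x (r/2))"
    using assms unfolding mtotally_bounded_def by (meson half_gt_zero)
  define S where "S Z \<longleftrightarrow> finite Z \<and> Z \<subseteq> A \<and> (\<forall>x\<in>Z. \<forall>y\<in>Z. x \<noteq> y \<longrightarrow> r < d x y)" for Z
  have "card Z \<le> card K" if Z: "S Z" for Z
  proof -
    have "Z \<subseteq> (\<Union>x\<in>K. mball x (r/2))" using Z K assms(2) by (auto simp: S_def)
    then have "\<forall>z\<in>Z. \<exists>k\<in>K. d k z < r/2" unfolding subset_iff UN_iff in_mball by blast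
    then obtain g where g: "\<And>z. z \<in> Z \<Longrightarrow> g z \<in> K \<and> d (g z) z < r/2" by metis
    have "inj_on g Z"
    proof (rule inj_onI, rule ccontr)
      fix x y assume xy: "x \<in> Z" "y \<in> Z" "g x = g y" "x \<noteq> y"
      then have "x \<in> M" "y \<in> M" "g x \<in> M" using Z assms g K by (auto simp: S_def)
      then have "d x y \<le> d (g x) x + d (g y) y" using triangle[of x "g x" y] xy by (simp add: commute)
      moreover have "r < d x y" using xy Z by (auto simp: S_def)
      ultimately show False using g[of x] g[of y] xy by linarith
    qed
    then show ?thesis using g K by (intro card_inj_on_le[of g]) auto
  qed
  then have bd: "\<forall>Z. S Z \<longrightarrow> card Z \<le> card K" by blast
  moreover have "S {}" by (simp add: S_def)
  ultimately have "\<exists>Z. S Z \<and> (\<forall>Y. S Y \<longrightarrow> card Y \<le> card Z)"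
    by (intro ex_has_greatest_nat[where k = "{}" and b = "Suc (card K)"]) (auto simp: less_Suc_eq_le)
  then obtain Z where Z: "S Z" "\<And>Y. S Y \<Longrightarrow> card Y \<le> card Z" by blast
  have "A \<subseteq> (\<Union>z\<in>Z. mcball z r)"
  proof (rule ccontr)
    assume "\<not> ?thesis"
    then obtain x where x: "x \<in> A" "\<And>z. z \<in> Z \<Longrightarrow> x \<notin> mcball z r" by blast
    have far: "r < d z x" if "z \<in> Z" for z
    proof -
      have "z \<in> M" "x \<in> M" using that Z(1) x(1) assms(2) by (auto simp: S_def)
      then show ?thesis using x(2)[OF that] by auto
    qed
    have "x \<in> M" using x(1) assms(2) by auto
    then have "x \<notin> Z" using far[of x] assms(3) by auto
    moreover have "S (insert x Z)" using Z x far unfolding S_def by (auto simp: commute)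
    ultimately show False using Z(2)[of "insert x Z"] Z(1) by (auto simp: S_def)
  qed
  then show thesis using Z that by (auto simp: S_def)
qed

end

section \<open>Weighted covers\<close>

context Metric_space
begin

text \<open>Weighted covers are no cheaper than ordinary covers, up to a constant and an arbitrarily small
loss of exponent. Group the sets by the dyadic scale of \<open>b i\<close>. The total weight of a point is at
least \<open>\<theta>\<close>, so some scale \<open>k\<close> gives it weight at least \<open>\<theta> * \<kappa> * q ^ k\<close>, where
\<open>q = (1/2) powr (s - t)\<close> and \<open>\<kappa>\<close> makes the geometric series sum to less than \<open>\<theta>\<close>. Let \<open>A k\<close>
be the set of these points. A set of scale \<open>k\<close> contains at most one point of a \<open>(1/2) ^ k\<close>-separated
subset of \<open>A k\<close>, which bounds the number of points of such a subset by the total weight \<open>V k\<close>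
of the scale. Balls around maximal separated sets form an ordinary cover, to which the content
bound applies.\<close>

lemma weighted_content_le:
  assumes tb: "mtotally_bounded M"
    and content: "content_ge s c"
    and c: "0 < c" and t: "0 < t" "t < s"
  obtains K where "0 < K"
    "\<And>\<theta> w E b. 0 < \<theta> \<Longrightarrow> weighted_cover w E b \<theta> \<Longrightarrow> (\<And>i. b i \<le> 1) \<Longrightarrow>
       ennreal \<theta> \<le> ennreal K * (\<Sum>i. w i * ennreal (b i powr t))"
proof -
  define q where "q = (1/2::real) powr (s - t)"
  have q: "0 < q" "q < 1" using t powr_less_mono2[of "s - t" "1/2" 1] by (auto simp: q_def)
  define \<kappa> where "\<kappa> = (1 - q) / 2"
  have \<kappa>: "0 < \<kappa>" using q by (simp add: \<kappa>_def)
  define K where "K = 2 powr s * 2 powr t / (\<kappa> * c)"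
  have K: "0 < K" using \<kappa> c by (simp add: K_def)
  have main: "ennreal \<theta> \<le> ennreal K * (\<Sum>i. w i * ennreal (b i powr t))"
    if \<theta>: "0 < \<theta>" and wc: "weighted_cover w E b \<theta>" and b1: "\<And>i. b i \<le> 1" for \<theta> w E b
  proof -
    have b: "\<And>i. 0 < b i" "\<And>i. b i \<le> 1"
      and dia: "\<And>i x y. x \<in> E i \<inter> M \<Longrightarrow> y \<in> E i \<inter> M \<Longrightarrow> d x y \<le> b i"
      and cov: "\<And>x. x \<in> M \<Longrightarrow> ennreal \<theta> \<le> (\<Sum>i. w i * indicator (E i) x)"
      using wc b1 unfolding weighted_cover_def by blast+
    have "\<exists>k. b i \<le> (1/2) ^ k \<and> (1/2) ^ k < 2 * b i" for i
      using dyadic_scale[OF b(1)[of i] b(2)[of i]] by blast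
    then obtain sc where sc: "\<And>i. b i \<le> (1/2) ^ sc i" "\<And>i. (1/2) ^ sc i < 2 * b i" by metis
    define W where "W k x = (\<Sum>i. if sc i = k then w i * indicator (E i) x else 0)" for k x
    define V where "V k = (\<Sum>i. if sc i = k then w i else 0)" for k
    define A where "A k = {x \<in> M. ennreal (\<theta> * \<kappa> * q ^ k) \<le> W k x}" for k
    \<comment> \<open>Every index has exactly one scale, so splitting a sum by scale loses nothing.\<close>
    have one: "(\<Sum>k. if sc i = k then v else 0) = v" for i and v :: ennreal
      by (subst suminf_finite[of "{sc i}"]) auto
    have Wsum: "(\<Sum>k. W k x) = (\<Sum>i. w i * indicator (E i) x)" for x
      unfolding W_def by (subst suminf_ennreal_swap) (simp add: one)
    have MA: "M \<subseteq> (\<Union>k. A k)"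
    proof
      fix x assume x: "x \<in> M"
      show "x \<in> (\<Union>k. A k)"
      proof (rule ccontr)
        assume "x \<notin> (\<Union>k. A k)"
        then have "W k x \<le> ennreal (\<theta> * \<kappa> * q ^ k)" for k using x by (auto simp: A_def not_le intro: less_imp_le)
        then have "(\<Sum>k. W k x) \<le> (\<Sum>k. ennreal (\<theta> * \<kappa> * q ^ k))" by (intro suminf_le) auto
        also have "\<dots> = ennreal (\<theta> * \<kappa> * (1 / (1 - q)))"
          using q \<theta> \<kappa> by (intro suminf_ennreal_eq sums_mult geometric_sums) auto
        also have "\<theta> * \<kappa> * (1 / (1 - q)) = \<theta> / 2" using q by (simp add: \<kappa>_def divide_simps)
        finally have "ennreal \<theta> \<le> ennreal (\<theta> / 2)" using cov[OF x] Wsum[of x] by simp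
        then show False using \<theta> by (simp add: ennreal_le_iff)
      qed
    qed
    have "\<exists>Z. finite Z \<and> Z \<subseteq> A k \<and> (\<forall>x\<in>Z. \<forall>y\<in>Z. x \<noteq> y \<longrightarrow> (1/2)^k < d x y) \<and>
              A k \<subseteq> (\<Union>z\<in>Z. mcball z ((1/2)^k))" for k
    proof -
      have "A k \<subseteq> M" "0 < (1/2::real)^k" by (auto simp: A_def)
      then show ?thesis by (rule maximal_separated_set[OF tb]) blast
    qed
    then obtain Z where Z: "\<And>k. finite (Z k)" "\<And>k. Z k \<subseteq> A k"
        "\<And>k x y. x \<in> Z k \<Longrightarrow> y \<in> Z k \<Longrightarrow> x \<noteq> y \<Longrightarrow> (1/2)^k < d x y"
        "\<And>k. A k \<subseteq> (\<Union>z\<in>Z k. mcball z ((1/2)^k))" by metis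
    have ZM: "Z k \<subseteq> M" for k using Z(2)[of k] by (auto simp: A_def)
    have count: "ennreal (real (card (Z k)) * (\<theta> * \<kappa> * q ^ k)) \<le> V k" for k
    proof -
      have "ennreal (real (card (Z k)) * (\<theta> * \<kappa> * q ^ k)) = (\<Sum>z\<in>Z k. ennreal (\<theta> * \<kappa> * q ^ k))"
        using \<theta> \<kappa> q by (simp add: ennreal_mult ennreal_of_nat_eq_real_of_nat)
      also have "\<dots> \<le> (\<Sum>z\<in>Z k. W k z)" using Z(2)[of k] by (intro sum_mono) (auto simp: A_def)
      also have "\<dots> = (\<Sum>i. \<Sum>z\<in>Z k. if sc i = k then w i * indicator (E i) z else 0)"
        unfolding W_def by (rule suminf_sum[symmetric]) auto
      also have "\<dots> \<le> V k" unfolding V_def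
      proof (intro suminf_le)
        fix i
        show "(\<Sum>z\<in>Z k. if sc i = k then w i * indicator (E i) z else 0) \<le> (if sc i = k then w i else 0)"
        proof (cases "sc i = k")
          case True
          have "card (Z k \<inter> E i) \<le> 1"
          proof -
            have "x = y" if "x \<in> Z k \<inter> E i" "y \<in> Z k \<inter> E i" for x y
            proof (rule ccontr)
              assume "x \<noteq> y"
              then have "(1/2)^k < d x y" using Z(3)[of x k y] that by auto
              moreover have "d x y \<le> b i" using that ZM[of k] by (intro dia) auto
              ultimately show False using sc(1)[of i] True by simp
            qed
            then show ?thesis using Z(1)[of k] by (auto simp: card_le_Suc0_iff_eq)
          qed
          moreover have "(\<Sum>z\<in>Z k. indicator (E i) z :: ennreal) = of_nat (card (Z k \<inter> E i))"
            using Z(1)[of k] by (simp add: indicator_def sum.If_cases Int_def)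
          ultimately have "(\<Sum>z\<in>Z k. indicator (E i) z :: ennreal) \<le> 1"
            by (metis of_nat_1 of_nat_le_iff)
          then have "w i * (\<Sum>z\<in>Z k. indicator (E i) z) \<le> w i * 1" by (rule mult_left_mono) simp
          then show ?thesis using True by (simp add: sum_distrib_left)
        qed auto
      qed auto
      finally show ?thesis .
    qed
    have "\<exists>e. bij_betw e {..<card (Z k)} (Z k)" for k
      using ex_bij_betw_nat_finite[OF Z(1)[of k]] by (simp add: atLeast0LessThan)
    then obtain e where e: "\<And>k. bij_betw (e k) {..<card (Z k)} (Z k)" by metis
    \<comment> \<open>The ordinary cover, indexed by scale and position in the net. Empty sets with bound 0 fill the
      unused positions; they cost nothing as 0 powr s = 0.\<close>
    define F where "F = (\<lambda>(k, j). if j < card (Z k) then mcball (e k j) ((1/2)^k) else {})"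
    define \<beta> where "\<beta> = (\<lambda>(k, j). if j < card (Z k) then 2 * (1/2)^k else (0::real))"
    have "ennreal c \<le> (\<Sum>i. ennreal (\<beta> (prod_decode i) powr s))"
    proof (rule content[unfolded content_ge_def, rule_format])
      show "M \<subseteq> (\<Union>i. F (prod_decode i))"
      proof
        fix x assume "x \<in> M"
        then obtain k z where kz: "z \<in> Z k" "x \<in> mcball z ((1/2)^k)" using MA Z(4) by blast
        have "z \<in> e k ` {..<card (Z k)}" using kz(1) by (simp add: bij_betw_imp_surj_on[OF e])
        then obtain j where "j < card (Z k)" "e k j = z" by blast
        then have "x \<in> F (prod_decode (prod_encode (k, j)))" using kz by (simp add: F_def)
        then show "x \<in> (\<Union>i. F (prod_decode i))" by blast
      qed
      fix i
      obtain k j where kj: "prod_decode i = (k, j)" by fastforce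
      have "d x y \<le> \<beta> (k, j)" if xy: "x \<in> F (k, j)" "y \<in> F (k, j)" for x y
      proof -
        have "j < card (Z k)" "x \<in> mcball (e k j) ((1/2)^k)" "y \<in> mcball (e k j) ((1/2)^k)"
          using xy by (auto simp: F_def split: if_splits)
        then show ?thesis using triangle[of x "e k j" y] by (simp add: \<beta>_def commute)
      qed
      moreover have "closedin mtopology (F (k, j))" "0 \<le> \<beta> (k, j)" by (auto simp: F_def \<beta>_def)
      ultimately show "closedin mtopology (F (prod_decode i)) \<and> 0 \<le> \<beta> (prod_decode i) \<and>
          (\<forall>x\<in>F (prod_decode i). \<forall>y\<in>F (prod_decode i). d x y \<le> \<beta> (prod_decode i))"
        unfolding kj by blast
    qed
    also have "\<dots> = (\<Sum>k. \<Sum>j. ennreal (\<beta> (k, j) powr s))"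
      by (rule suminf_ennreal_2dimen) simp
    also have "\<dots> \<le> (\<Sum>k. ennreal (2 powr s / (\<theta> * \<kappa>) * ((1/2)^k) powr t) * V k)"
    proof (intro suminf_le)
      fix k
      have "(\<Sum>j. ennreal (\<beta> (k, j) powr s)) = (\<Sum>j<card (Z k). ennreal (\<beta> (k, j) powr s))"
        using t by (intro suminf_finite) (auto simp: \<beta>_def)
      also have "\<dots> = (\<Sum>j<card (Z k). ennreal ((2 * (1/2)^k) powr s))"
        by (intro sum.cong) (auto simp: \<beta>_def)
      also have "\<dots> = ennreal (real (card (Z k)) * (2 * (1/2)^k) powr s)"
        by (simp add: ennreal_mult ennreal_of_nat_eq_real_of_nat)
      also have "(2 * (1/2)^k) powr s = 2 powr s / (\<theta> * \<kappa>) * ((1/2)^k) powr t * (\<theta> * \<kappa> * q ^ k)"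
      proof -
        \<comment> \<open>The factor q ^ k in the threshold accounts exactly for the change of exponent from s to t.\<close>
        have "q ^ k = ((1/2)^k) powr (s - t)"
          by (simp add: q_def powr_powr mult.commute flip: powr_realpow)
        then have "((1/2)^k) powr s = ((1/2)^k) powr t * q ^ k" by (simp flip: powr_add)
        then show ?thesis using \<theta> \<kappa> by (simp add: powr_mult)
      qed
      also have "real (card (Z k)) * \<dots> = 2 powr s / (\<theta> * \<kappa>) * ((1/2)^k) powr t * (real (card (Z k)) * (\<theta> * \<kappa> * q ^ k))"
        by (simp add: mult_ac)
      also have "ennreal \<dots> = ennreal (2 powr s / (\<theta> * \<kappa>) * ((1/2)^k) powr t) * ennreal (real (card (Z k)) * (\<theta> * \<kappa> * q ^ k))"
        using \<theta> \<kappa> q by (intro ennreal_mult) auto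
      also have "\<dots> \<le> ennreal (2 powr s / (\<theta> * \<kappa>) * ((1/2)^k) powr t) * V k"
        by (intro mult_left_mono count) auto
      finally show "(\<Sum>j. ennreal (\<beta> (k, j) powr s)) \<le> \<dots>" .
    qed auto
    also have "\<dots> = (\<Sum>k. \<Sum>i. ennreal (2 powr s / (\<theta> * \<kappa>) * ((1/2)^k) powr t) * (if sc i = k then w i else 0))"
      unfolding V_def by simp
    also have "\<dots> = (\<Sum>i. \<Sum>k. ennreal (2 powr s / (\<theta> * \<kappa>) * ((1/2)^k) powr t) * (if sc i = k then w i else 0))"
      by (rule suminf_ennreal_swap)
    also have "\<dots> = (\<Sum>i. ennreal (2 powr s / (\<theta> * \<kappa>) * ((1/2)^sc i) powr t) * w i)"
    proof (rule suminf_cong)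
      fix i
      show "(\<Sum>k. ennreal (2 powr s / (\<theta> * \<kappa>) * ((1/2)^k) powr t) * (if sc i = k then w i else 0))
          = ennreal (2 powr s / (\<theta> * \<kappa>) * ((1/2)^sc i) powr t) * w i"
        by (subst suminf_finite[of "{sc i}"]) auto
    qed
    also have "\<dots> \<le> (\<Sum>i. ennreal (K * c / \<theta>) * (w i * ennreal (b i powr t)))"
    proof (intro suminf_le)
      fix i
      have "2 powr s / (\<theta> * \<kappa>) * ((1/2)^sc i) powr t \<le> 2 powr s / (\<theta> * \<kappa>) * (2 * b i) powr t"
        using sc(2)[of i] t \<theta> \<kappa> by (intro mult_left_mono powr_mono2) auto
      also have "\<dots> = K * c / \<theta> * b i powr t"
        using c \<theta> \<kappa> b[of i] by (simp add: K_def powr_mult field_simps)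
      finally have "ennreal (2 powr s / (\<theta> * \<kappa>) * ((1/2)^sc i) powr t) \<le> ennreal (K * c / \<theta>) * ennreal (b i powr t)"
        using K c \<theta> by (subst ennreal_mult[symmetric]) (auto intro: ennreal_leI)
      then have "ennreal (2 powr s / (\<theta> * \<kappa>) * ((1/2)^sc i) powr t) * w i \<le> ennreal (K * c / \<theta>) * ennreal (b i powr t) * w i"
        by (rule mult_right_mono) simp
      then show "ennreal (2 powr s / (\<theta> * \<kappa>) * ((1/2)^sc i) powr t) * w i \<le> ennreal (K * c / \<theta>) * (w i * ennreal (b i powr t))"
        by (simp add: mult_ac)
    qed auto
    also have "\<dots> = ennreal (K * c / \<theta>) * (\<Sum>i. w i * ennreal (b i powr t))" by simp
    finally have "ennreal (\<theta> / c) * ennreal c \<le> ennreal (\<theta> / c) * (ennreal (K * c / \<theta>) * (\<Sum>i. w i * ennreal (b i powr t)))"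
      by (rule mult_left_mono) simp
    also have "\<dots> = ennreal (\<theta> / c) * ennreal (K * c / \<theta>) * (\<Sum>i. w i * ennreal (b i powr t))"
      by (simp add: mult.assoc)
    also have "ennreal (\<theta> / c) * ennreal (K * c / \<theta>) = ennreal K"
      using c \<theta> K by (subst ennreal_mult[symmetric]) auto
    also have "ennreal (\<theta> / c) * ennreal c = ennreal \<theta>"
      using c \<theta> by (subst ennreal_mult[symmetric]) auto
    finally show ?thesis .
  qed
  show thesis by (rule that[OF K main])
qed

text \<open>Where the gauge is truncated, a set counts with its full weight. If these big sets have total
weight \<open>U < 1\<close>, the remaining sets give every point weight at least \<open>1 - U\<close>, and the
homogeneous bound for them with \<open>\<theta> = 1 - U\<close> makes up for the difference. This is why
\<open>weighted_content_le\<close> is stated for all \<open>\<theta>\<close>.\<close>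

lemma truncated_gauge_weighted_cover:
  assumes K: "\<And>\<theta> w E b. 0 < \<theta> \<Longrightarrow> weighted_cover w E b \<theta> \<Longrightarrow> (\<And>i. b i \<le> 1) \<Longrightarrow>
       ennreal \<theta> \<le> ennreal K * (\<Sum>i. w i * ennreal (b i powr t))"
    and t: "0 < t" and C: "1 \<le> C" "K \<le> C"
    and wc: "weighted_cover w E b 1"
  shows "1 \<le> (\<Sum>i. w i * ennreal (min 1 (C * b i powr t)))"
proof -
  have b: "\<And>i. 0 < b i"
    and dia: "\<And>i x y. x \<in> E i \<inter> M \<Longrightarrow> y \<in> E i \<inter> M \<Longrightarrow> d x y \<le> b i"
    and cov: "\<And>x. x \<in> M \<Longrightarrow> 1 \<le> (\<Sum>i. w i * indicator (E i) x)"
    using wc unfolding weighted_cover_def by auto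
  define big where "big i \<longleftrightarrow> 1 \<le> C * b i powr t" for i
  define u where "u i = (if big i then w i else 0)" for i
  define v where "v i = (if big i then 0 else w i)" for i
  define U where "U = (\<Sum>i. u i)"
  have w: "w i = u i + v i" for i by (auto simp: u_def v_def)
  have rhs: "(\<Sum>i. w i * ennreal (min 1 (C * b i powr t))) = U + ennreal C * (\<Sum>i. v i * ennreal (b i powr t))"
  proof -
    have "w i * ennreal (min 1 (C * b i powr t)) = u i + ennreal C * (v i * ennreal (b i powr t))" for i
      using C by (auto simp: u_def v_def big_def min_def ennreal_mult mult_ac)
    then show ?thesis unfolding U_def by (simp add: suminf_add[symmetric])
  qed
  show ?thesis
  proof (cases "1 \<le> U")
    case True
    then show ?thesis unfolding rhs by (meson add_increasing2 zero_le)
  next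
    case False
    then have "U < top" using less_trans[OF _ ennreal_one_less_top] by (simp add: not_le)
    then obtain U' where U': "U = ennreal U'" "0 \<le> U'" by (cases U) auto
    have U1: "U' < 1" using False U' by (simp add: not_le ennreal_less_one_iff)
    have small: "b i \<le> 1" if "\<not> big i" for i
    proof (rule ccontr)
      assume "\<not> b i \<le> 1"
      then have "1 \<le> b i powr t" using t by (intro ge_one_powr_ge_zero) auto
      then have "1 * 1 \<le> C * b i powr t" using C by (intro mult_mono) auto
      then show False using that by (simp add: big_def)
    qed
    \<comment> \<open>The big sets are replaced by empty ones. Their bounds are cut at 1, as the comparison only
      covers bounds up to 1; for the other sets this changes nothing.\<close>
    have "ennreal (1 - U') \<le> ennreal K * (\<Sum>i. v i * ennreal (min 1 (b i) powr t))"
    proof (rule K)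
      show "0 < 1 - U'" using U1 by simp
      have "d x y \<le> min 1 (b i)"
        if "x \<in> (if big i then {} else E i) \<inter> M" "y \<in> (if big i then {} else E i) \<inter> M" for i x y
        using that dia[of x i y] small[of i] by (auto split: if_splits)
      moreover have "ennreal (1 - U') \<le> (\<Sum>i. v i * indicator (if big i then {} else E i) x)"
        if x: "x \<in> M" for x
      proof -
        have "1 \<le> (\<Sum>i. w i * indicator (E i) x)" by (rule cov[OF x])
        also have "\<dots> \<le> (\<Sum>i. u i + v i * indicator (if big i then {} else E i) x)"
          by (intro suminf_le) (auto simp: u_def v_def indicator_def)
        also have "\<dots> = U + (\<Sum>i. v i * indicator (if big i then {} else E i) x)"
          unfolding U_def by (simp add: suminf_add[symmetric])
        finally have "1 - U \<le> (\<Sum>i. v i * indicator (if big i then {} else E i) x)"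
          by (simp add: ennreal_minus_le_iff)
        moreover have "ennreal (1 - U') = 1 - U" using U' U1 by (simp add: ennreal_minus flip: ennreal_1)
        ultimately show ?thesis by simp
      qed
      moreover have "0 < min 1 (b i)" for i using b by simp
      ultimately show "weighted_cover v (\<lambda>i. if big i then {} else E i) (\<lambda>i. min 1 (b i)) (1 - U')"
        unfolding weighted_cover_def by blast
    qed simp
    also have "(\<Sum>i. v i * ennreal (min 1 (b i) powr t)) = (\<Sum>i. v i * ennreal (b i powr t))"
    proof (rule suminf_cong)
      fix i show "v i * ennreal (min 1 (b i) powr t) = v i * ennreal (b i powr t)"
        using small[of i] by (cases "big i") (auto simp: v_def min_def)
    qed
    also have "ennreal K * \<dots> \<le> ennreal C * \<dots>" using C by (intro mult_right_mono ennreal_leI) auto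
    finally have "U + ennreal (1 - U') \<le> U + ennreal C * (\<Sum>i. v i * ennreal (b i powr t))"
      by (rule add_left_mono)
    moreover have "U + ennreal (1 - U') = 1" using U' U1 by (simp add: ennreal_plus[symmetric] del: ennreal_plus)
    ultimately show ?thesis unfolding rhs by simp
  qed
qed

end

section \<open>The metric of the Hilbert cube and slicing of covers\<close>

lemma finite_sum_geometric_tail_le:
  fixes q :: real
  assumes "finite F" "0 \<le> q" "q < 1" "\<And>n. n \<in> F \<Longrightarrow> N < n"
  shows "(\<Sum>n\<in>F. q ^ n) \<le> q ^ (N + 1) / (1 - q)"
proof -
  define G where "G = (\<lambda>n. n - (N + 1)) ` F"
  have inj: "inj_on (\<lambda>n. n - (N + 1)) F"
  proof (rule inj_onI)
    fix x y assume "x \<in> F" "y \<in> F" "x - (N + 1) = y - (N + 1)"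
    then show "x = y" using assms(4)[of x] assms(4)[of y] by linarith
  qed
  have "(\<Sum>n\<in>F. q ^ n) = (\<Sum>n\<in>F. q ^ (N + 1) * q ^ (n - (N + 1)))"
  proof (rule sum.cong)
    fix n assume "n \<in> F"
    then have "n = (N + 1) + (n - (N + 1))" using assms(4)[of n] by simp
    then show "q ^ n = q ^ (N + 1) * q ^ (n - (N + 1))" by (metis power_add)
  qed simp
  also have "\<dots> = q ^ (N + 1) * (\<Sum>n\<in>G. q ^ n)"
    unfolding G_def sum.reindex[OF inj] o_def by (rule sum_distrib_left[symmetric])
  also have "\<dots> \<le> q ^ (N + 1) * (1 / (1 - q))"
  proof (rule mult_left_mono)
    have "(\<Sum>n\<in>G. q ^ n) \<le> (\<Sum>n. q ^ n)"
      using assms by (intro sum_le_suminf summable_geometric) (auto simp: G_def)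
    then show "(\<Sum>n\<in>G. q ^ n) \<le> 1 / (1 - q)" using assms by (simp add: suminf_geometric)
  qed (use assms in auto)
  finally show ?thesis by simp
qed

lemma power_of_square_summable_on:
  assumes "0 < lam" "lam < (1::real)"
  shows "(\<lambda>n. (lam ^ n)\<^sup>2) summable_on A"
proof -
  have "summable (\<lambda>n. (lam\<^sup>2) ^ n)"
    using assms by (intro summable_geometric) (auto simp: power_less_one_iff)
  then have "(\<lambda>n. (lam\<^sup>2) ^ n) summable_on UNIV"
    by (intro norm_summable_imp_summable_on) simp
  then have "(\<lambda>n. (lam\<^sup>2) ^ n) summable_on A" by (rule summable_on_subset) simp
  then show ?thesis by (simp add: power_commutes flip: power_mult) (simp add: mult.commute)
qed

context Metric_space
begin

lemma HC_dist_summable: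
  assumes "0 < lam" "lam < 1" "x \<in> HC M" "y \<in> HC M" and B: "\<And>x y. x \<in> M \<Longrightarrow> y \<in> M \<Longrightarrow> d x y \<le> B"
  shows "(\<lambda>n. (lam ^ n)\<^sup>2 * (d (x n) (y n))\<^sup>2) summable_on {1..}"
proof (rule summable_on_comparison_test)
  show "(\<lambda>n. (lam ^ n)\<^sup>2 * B\<^sup>2) summable_on {1..}"
    by (intro summable_on_cmult_left power_of_square_summable_on assms)
  fix n :: nat assume n: "n \<in> {1..}"
  then have "d (x n) (y n) \<le> B" using assms by (auto simp: HC_def PiE_iff)
  then show "(lam ^ n)\<^sup>2 * (d (x n) (y n))\<^sup>2 \<le> (lam ^ n)\<^sup>2 * B\<^sup>2"
    by (intro mult_left_mono power_mono) auto
qed auto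

lemma coordinate_le_HC_dist:
  assumes "0 < lam" "lam < 1" "x \<in> HC M" "y \<in> HC M" "mbounded M" "1 \<le> n"
  shows "lam ^ n * d (x n) (y n) \<le> HC_dist d (\<lambda>n. lam ^ n) x y"
proof -
  obtain B where B: "\<And>x y. x \<in> M \<Longrightarrow> y \<in> M \<Longrightarrow> d x y \<le> B"
    using assms unfolding mbounded_alt by blast
  have "(\<Sum>n\<in>{n}. (lam ^ n)\<^sup>2 * (d (x n) (y n))\<^sup>2) \<le> (\<Sum>\<^sub>\<infinity>n\<in>{1..}. (lam ^ n)\<^sup>2 * (d (x n) (y n))\<^sup>2)"
    using assms by (intro finite_sum_le_infsum HC_dist_summable[where B = B] B) auto
  then have "sqrt ((lam ^ n * d (x n) (y n))\<^sup>2) \<le> HC_dist d (\<lambda>n. lam ^ n) x y"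
    unfolding HC_dist_def by (intro real_sqrt_le_mono) (simp add: power_mult_distrib)
  then show ?thesis using assms by simp
qed

text \<open>Coordinates up to \<open>N\<close> are controlled individually, and the geometric weights take care of the
others, for which only the diameter of the factor is known.\<close>

lemma HC_dist_le:
  assumes lam: "0 < lam" "lam < 1" and xy: "x \<in> HC M" "y \<in> HC M"
    and B: "\<And>x y. x \<in> M \<Longrightarrow> y \<in> M \<Longrightarrow> d x y \<le> B"
    and head: "\<And>n. 1 \<le> n \<Longrightarrow> n \<le> N \<Longrightarrow> lam ^ n * d (x n) (y n) \<le> a" and "0 \<le> a"
  shows "(HC_dist d (\<lambda>n. lam ^ n) x y)\<^sup>2 \<le> real N * a\<^sup>2 + B\<^sup>2 * (lam\<^sup>2) ^ (N + 1) / (1 - lam\<^sup>2)"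
proof -
  define g where "g n = (lam ^ n)\<^sup>2 * (d (x n) (y n))\<^sup>2" for n
  have lam2: "0 < lam\<^sup>2" "lam\<^sup>2 < 1" using lam by (auto simp: power_less_one_iff)
  have g0: "0 \<le> g n" for n by (simp add: g_def)
  have "infsum g {1..} \<le> real N * a\<^sup>2 + B\<^sup>2 * (lam\<^sup>2) ^ (N + 1) / (1 - lam\<^sup>2)"
  proof (rule infsum_le_finite_sums)
    show "g summable_on {1..}" unfolding g_def by (rule HC_dist_summable[OF lam xy B])
    fix F :: "nat set" assume F: "finite F" "F \<subseteq> {1..}"
    have "sum g F = sum g (F \<inter> {..N}) + sum g (F \<inter> {N<..})"
      using F by (subst sum.union_disjoint[symmetric]) (auto intro!: sum.cong)
    also have "sum g (F \<inter> {..N}) \<le> real (card (F \<inter> {..N})) * a\<^sup>2"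
    proof (rule sum_bounded_above)
      fix n assume n: "n \<in> F \<inter> {..N}"
      then have "1 \<le> n" "n \<le> N" using F by auto
      then have "(lam ^ n * d (x n) (y n))\<^sup>2 \<le> a\<^sup>2"
        using head[of n] lam by (intro power_mono) auto
      then show "g n \<le> a\<^sup>2" by (simp add: g_def power_mult_distrib)
    qed
    also have "\<dots> \<le> real N * a\<^sup>2"
    proof -
      have "card (F \<inter> {..N}) \<le> card {1..N}" using F by (intro card_mono) auto
      then show ?thesis by (intro mult_right_mono) auto
    qed
    also have "sum g (F \<inter> {N<..}) \<le> (\<Sum>n\<in>F \<inter> {N<..}. B\<^sup>2 * (lam\<^sup>2) ^ n)"
    proof (rule sum_mono)
      fix n assume n: "n \<in> F \<inter> {N<..}"
      then have "d (x n) (y n) \<le> B" using F xy B by (auto simp: HC_def PiE_iff)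
      then have "(d (x n) (y n))\<^sup>2 \<le> B\<^sup>2" by (intro power_mono) auto
      moreover have "(lam ^ n)\<^sup>2 = (lam\<^sup>2) ^ n" by (simp add: mult.commute flip: power_mult)
      ultimately show "g n \<le> B\<^sup>2 * (lam\<^sup>2) ^ n"
        unfolding g_def using lam2 by (simp add: mult.commute mult_left_mono)
    qed
    also have "\<dots> = B\<^sup>2 * (\<Sum>n\<in>F \<inter> {N<..}. (lam\<^sup>2) ^ n)" by (simp add: sum_distrib_left)
    also have "\<dots> \<le> B\<^sup>2 * ((lam\<^sup>2) ^ (N + 1) / (1 - lam\<^sup>2))"
      using F lam2 by (intro mult_left_mono finite_sum_geometric_tail_le) auto
    finally show "sum g F \<le> real N * a\<^sup>2 + B\<^sup>2 * (lam\<^sup>2) ^ (N + 1) / (1 - lam\<^sup>2)" by simp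
  qed
  moreover have "0 \<le> infsum g {1..}" using g0 by (intro infsum_nonneg)
  ultimately show ?thesis unfolding HC_dist_def g_def[symmetric] by simp
qed

lemma Metric_space_HC_powers:
  assumes "compact_space mtopology" "0 < lam" "lam < 1"
  shows "Metric_space (HC M) (HC_dist d (\<lambda>n. lam ^ n))"
  using assms Metric_space_axioms
  by (intro Metric_space_HC power_of_square_summable_on) auto

text \<open>\<open>P k r\<close> stands for the product of \<open>m (r / lam ^ n)\<close> over \<open>n > k\<close>, of which only the recursion
and the eventual value \<open>1\<close> matter. In the proof, \<open>T k x\<close> is the set of indices \<open>i\<close> for which
\<open>E i\<close> meets the cylinder of all sequences agreeing with \<open>x\<close> in the first \<open>k\<close> coordinates, and
\<open>\<Sigma> k x\<close> is the sum of \<open>P k (r i)\<close> over it. The projections to coordinate \<open>k + 1\<close> of the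
sets counted in \<open>\<Sigma> k x\<close>, with weights \<open>P (k + 1) (r i)\<close>, cannot form a weighted cover if
\<open>\<Sigma> k x < 1\<close>, so the next coordinate can be chosen in such a way that the sum stays below \<open>1\<close>.\<close>

lemma HC_cover_sum_ge_1:
  fixes m :: "real \<Rightarrow> real" and P :: "nat \<Rightarrow> real \<Rightarrow> real"
  assumes lam: "0 < lam" "lam < 1" and bd: "mbounded M"
    and m: "\<And>w E b. weighted_cover w E b 1 \<Longrightarrow> 1 \<le> (\<Sum>i. w i * ennreal (m (b i)))"
    and m0: "\<And>r. 0 \<le> m r"
    and P: "\<And>k r. 0 < r \<Longrightarrow> P k r = P (Suc k) r * m (r / lam ^ Suc k)"
    and P0: "\<And>k r. 0 \<le> P k r"
    and P1: "\<And>r. 0 < r \<Longrightarrow> \<exists>k. P k r = 1"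
    and cov: "HC M \<subseteq> (\<Union>i. E i)" and r: "\<And>i. 0 < r i"
    and dia: "\<And>i x y. x \<in> E i \<inter> HC M \<Longrightarrow> y \<in> E i \<inter> HC M \<Longrightarrow> HC_dist d (\<lambda>n. lam ^ n) x y \<le> r i"
  shows "1 \<le> (\<Sum>i::nat. ennreal (P 0 (r i)))"
proof (rule ccontr)
  assume neg: "\<not> ?thesis"
  define T where "T k x = {i. \<exists>y\<in>E i \<inter> HC M. \<forall>n\<in>{1..k}. y n = x n}" for k and x :: "nat \<Rightarrow> 'a"
  define \<Sigma> where "\<Sigma> k x = (\<Sum>i. ennreal (P k (r i)) * indicator (T k x) i)" for k x
  have Tcong: "T k x = T k y" if "\<forall>n\<in>{1..k}. x n = y n" for k x y
    unfolding T_def using that by auto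
  have step: "\<exists>a\<in>M. \<Sigma> (Suc k) (x(Suc k := a)) < 1" if "\<Sigma> k x < 1" for k x
  proof (rule ccontr)
    assume *: "\<not> ?thesis"
    define G where "G i = {a. i \<in> T (Suc k) (x(Suc k := a))}" for i
    define w where "w i = ennreal (P (Suc k) (r i)) * indicator (T k x) i" for i
    have "1 \<le> (\<Sum>i. w i * ennreal (m (r i / lam ^ Suc k)))"
    proof (rule m)
      have "0 < r i / lam ^ Suc k" for i using r[of i] lam by simp
      moreover have "d a b \<le> r i / lam ^ Suc k" if ab: "a \<in> G i \<inter> M" "b \<in> G i \<inter> M" for i a b
      proof -
        obtain y where y: "y \<in> E i \<inter> HC M" "y (Suc k) = a"
          using ab(1) unfolding G_def T_def by fastforce
        obtain z where z: "z \<in> E i \<inter> HC M" "z (Suc k) = b"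
          using ab(2) unfolding G_def T_def by fastforce
        have "lam ^ Suc k * d a b \<le> HC_dist d (\<lambda>n. lam ^ n) y z"
          using coordinate_le_HC_dist[OF lam _ _ bd, of y z "Suc k"] y z by simp
        also have "\<dots> \<le> r i" using y z by (intro dia) auto
        finally show ?thesis using lam by (simp add: field_simps)
      qed
      moreover have "1 \<le> (\<Sum>i. w i * indicator (G i) a)" if a: "a \<in> M" for a
      proof -
      have "1 \<le> \<Sigma> (Suc k) (x(Suc k := a))" using * a by (auto simp: not_less)
      also have "\<dots> \<le> (\<Sum>i. w i * indicator (G i) a)" unfolding \<Sigma>_def
      proof (intro suminf_le)
        fix i
        have "i \<in> T k x" if i: "i \<in> T (Suc k) (x(Suc k := a))"
        proof -
          obtain y where "y \<in> E i \<inter> HC M" "\<forall>n\<in>{1..Suc k}. y n = (x(Suc k := a)) n"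
            using i unfolding T_def by blast
          then have "\<forall>n\<in>{1..k}. y n = x n" by auto
          then show ?thesis unfolding T_def using \<open>y \<in> _\<close> by blast
        qed
        then show "ennreal (P (Suc k) (r i)) * indicator (T (Suc k) (x(Suc k := a))) i \<le> w i * indicator (G i) a"
          by (auto simp: w_def G_def indicator_def)
      qed auto
      finally show ?thesis .
      qed
      ultimately show "weighted_cover w G (\<lambda>i. r i / lam ^ Suc k) 1"
        unfolding weighted_cover_def ennreal_1 by blast
    qed
    also have "\<dots> = \<Sigma> k x" unfolding \<Sigma>_def w_def
      by (intro suminf_cong) (simp add: P[OF r, of k] ennreal_mult P0 m0 mult_ac)
    finally show False using that by simp
  qed
  define R where "R k x \<longleftrightarrow> (\<forall>n\<in>{1..k}. x n \<in> M) \<and> \<Sigma> k x < 1" for k and x :: "nat \<Rightarrow> 'a"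
  have "\<exists>f. \<forall>k. R k (f k) \<and> (\<forall>n\<in>{1..k}. f (Suc k) n = f k n)"
  proof (rule dependent_nat_choice)
    have "\<Sigma> 0 undefined \<le> (\<Sum>i. ennreal (P 0 (r i)))"
      unfolding \<Sigma>_def by (intro suminf_le) (auto simp: indicator_def)
    then have "R 0 undefined" using neg by (auto simp: R_def)
    then show "\<exists>x. R 0 x" by blast
  next
    fix x k assume x: "R k x"
    then obtain a where a: "a \<in> M" "\<Sigma> (Suc k) (x(Suc k := a)) < 1" using step[of k x] by (auto simp: R_def)
    then show "\<exists>y. R (Suc k) y \<and> (\<forall>n\<in>{1..k}. y n = x n)"
      using x by (intro exI[of _ "x(Suc k := a)"]) (auto simp: R_def)
  qed
  then obtain f where f: "\<And>k. R k (f k)" "\<And>k n. n \<in> {1..k} \<Longrightarrow> f (Suc k) n = f k n" by blast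
  \<comment> \<open>The choices are compatible, and the diagonal reads off the point they determine.\<close>
  define x where "x = restrict (\<lambda>n. f n n) {1..}"
  have fx: "f (n + j) n = f n n" if "1 \<le> n" for n j
    by (induction j) (use f(2) that in auto)
  have agree: "\<forall>n\<in>{1..k}. x n = f k n" for k
  proof
    fix n assume "n \<in> {1..k}"
    then show "x n = f k n" using fx[of n "k - n"] by (simp add: x_def)
  qed
  have xH: "x \<in> HC M" unfolding HC_def x_def using f(1) by (auto simp: R_def)
  then obtain j where j: "x \<in> E j" using cov by auto
  obtain k where k: "P k (r j) = 1" using P1[OF r] by blast
  have term_le_suminf: "h j \<le> suminf h" for h :: "nat \<Rightarrow> ennreal"
    using sum_le_suminf[of h "{j}"] by simp
  have "j \<in> T k x" unfolding T_def using j xH by auto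
  then have "1 = ennreal (P k (r j)) * indicator (T k x) j" using k by simp
  also have "\<dots> \<le> \<Sigma> k x" unfolding \<Sigma>_def by (rule term_le_suminf)
  also have "\<dots> = \<Sigma> k (f k)" unfolding \<Sigma>_def using Tcong[OF agree[of k]] by simp
  also have "\<dots> < 1" using f(1)[of k] by (simp add: R_def)
  finally show False by simp
qed

end

section \<open>The fine gauge and the lower bound\<close>

definition fine_gauge :: "real \<Rightarrow> real \<Rightarrow> real" where
  "fine_gauge s r = (if r = 0 then 0 else exp (- (s * (ln (1 / r))\<^sup>2)))"

lemma fine_scale_eq: "fine_scale = ({0<..}, fine_gauge)"
  by (simp add: fine_scale_def fine_gauge_def fun_eq_iff)

lemma fine_gauge_0 [simp]: "fine_gauge s 0 = 0" by (simp add: fine_gauge_def)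

lemma fine_gauge_mono:
  assumes "0 \<le> s" "0 \<le> r" "r \<le> r'" "r' \<le> 1"
  shows "fine_gauge s r \<le> fine_gauge s r'"
proof (cases "r = 0")
  case False
  then have "0 \<le> ln (1 / r')" "ln (1 / r') \<le> ln (1 / r)" using assms by (auto simp: frac_le)
  then have "(ln (1 / r'))\<^sup>2 \<le> (ln (1 / r))\<^sup>2" by (intro power_mono) auto
  then show ?thesis using False assms by (auto simp: fine_gauge_def intro!: mult_left_mono)
qed (auto simp: fine_gauge_def)

lemma fine_gauge_right_continuous:
  assumes "0 < s" "0 \<le> r"
  shows "(fine_gauge s \<longlongrightarrow> fine_gauge s r) (at_right r)"
proof (cases "r = 0")
  case True
  have "((\<lambda>r. exp (- (s * (ln (1 / r))\<^sup>2))) \<longlongrightarrow> 0) (at_right 0)"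
    using assms by real_asymp
  moreover have "\<forall>\<^sub>F x in at_right 0. exp (- (s * (ln (1 / x))\<^sup>2)) = fine_gauge s x"
    by (intro eventually_at_rightI[of 0 1]) (auto simp: fine_gauge_def)
  ultimately show ?thesis using True by (auto intro: Lim_transform_eventually)
next
  case False
  then have r: "0 < r" using assms by simp
  have "((\<lambda>r. exp (- (s * (ln (1 / r))\<^sup>2))) \<longlongrightarrow> exp (- (s * (ln (1 / r))\<^sup>2))) (at_right r)"
    using r by (intro tendsto_intros) auto
  moreover have "\<forall>\<^sub>F x in at_right r. exp (- (s * (ln (1 / x))\<^sup>2)) = fine_gauge s x"
    using r by (intro eventually_at_rightI[of r "r+1"]) (auto simp: fine_gauge_def)
  ultimately show ?thesis using False by (auto simp: fine_gauge_def[of s r] intro: Lim_transform_eventually)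
qed

text \<open>Sets with one point have diameter \<open>0\<close> and cost nothing, but products over coordinates make sense for
positive radii only. Right continuity allows all radii of a cover to be enlarged at an
arbitrarily small total cost.\<close>

lemma fine_gauge_slightly_larger:
  assumes "0 < s" "0 \<le> r" "r < b" "0 < e"
  obtains r' where "r < r'" "r' < b" "fine_gauge s r' \<le> fine_gauge s r + e"
proof -
  have "\<forall>\<^sub>F x in at_right r. fine_gauge s x < fine_gauge s r + e"
    using fine_gauge_right_continuous[OF assms(1,2)] assms(4) by (intro order_tendstoD) auto
  moreover have "\<forall>\<^sub>F x in at_right r. x \<in> {r<..<b}"
    using assms(3) by (rule eventually_at_right_real)
  ultimately have "\<forall>\<^sub>F x in at_right r. fine_gauge s x < fine_gauge s r + e \<and> x \<in> {r<..<b}"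
    by (rule eventually_conj)
  then obtain x where "fine_gauge s x < fine_gauge s r + e" "x \<in> {r<..<b}"
    using eventually_happens[of _ "at_right r"] by (auto simp: trivial_limit_at_right_real)
  then show thesis using that[of x] by auto
qed

text \<open>Beyond \<open>N = \<lfloor>L / l\<rfloor>\<close> the truncated gauge equals \<open>1\<close>. Up to \<open>N\<close> the exponents \<open>n * l - L\<close> form
an arithmetic progression, whose sum is \<open>- L\<^sup>2 / (2 * l)\<close> up to linear terms in \<open>L\<close>; completing the
square at \<open>N = L / l\<close> makes this precise.\<close>

lemma product_of_truncated_powers_le:
  fixes r lam C t :: real
  defines "l \<equiv> ln (1 / lam)" and "L \<equiv> ln (1 / r)"
  defines "N \<equiv> nat \<lfloor>L / l\<rfloor>"
  assumes "0 < lam" "lam < 1" "1 \<le> C" "0 < t" "0 < r" "r < 1"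
  shows "(\<Prod>n\<in>{0<..N}. min 1 (C * (r / lam ^ n) powr t))
     \<le> exp (- (t / (2 * l)) * L\<^sup>2 + (ln C / l + t / 2) * L + t * l / 2)"
proof -
  have l: "0 < l" and L: "0 < L" using assms by (auto simp: l_def L_def)
  have "of_int \<lfloor>L / l\<rfloor> \<le> L / l" "L / l < of_int \<lfloor>L / l\<rfloor> + 1" "0 \<le> \<lfloor>L / l\<rfloor>"
    using l L by (auto simp: less_imp_le)
  then have N: "real N \<le> L / l" "L / l \<le> real N + 1" unfolding N_def by auto
  have "(\<Prod>n\<in>{0<..N}. min 1 (C * (r / lam ^ n) powr t)) \<le> (\<Prod>n\<in>{0<..N}. exp (ln C + t * (real n * l - L)))"
  proof (rule prod_mono)
    fix n
    have "C * (r / lam ^ n) powr t = exp (ln C + t * (real n * l - L))"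
    proof -
      have "ln (r / lam ^ n) = real n * l - L"
        using assms(4-9) by (simp add: l_def L_def ln_div ln_realpow)
      then show ?thesis using assms by (simp add: exp_add powr_def)
    qed
    then show "0 \<le> min 1 (C * (r / lam ^ n) powr t) \<and> min 1 (C * (r / lam ^ n) powr t) \<le> exp (ln C + t * (real n * l - L))"
      by simp
  qed
  also have "\<dots> = exp (\<Sum>n\<in>{0<..N}. ln C + t * (real n * l - L))"
    by (simp add: exp_sum)
  also have "(\<Sum>n\<in>{0<..N}. ln C + t * (real n * l - L)) = real N * ln C + t * (l * (real N * (real N + 1) / 2) - L * real N)"
  proof (induction N)
    case (Suc N)
    have "{0<..Suc N} = insert (Suc N) {0<..N}" by auto
    then show ?case using Suc by (simp add: field_simps)
  qed simp
  also have "\<dots> \<le> - (t / (2 * l)) * L\<^sup>2 + (ln C / l + t / 2) * L + t * l / 2"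
  proof -
    have "real N * ln C \<le> L / l * ln C" using N assms by (intro mult_right_mono) auto
    moreover have "l * (real N * (real N + 1) / 2) - L * real N \<le> l / 2 - L\<^sup>2 / (2 * l) + L / 2"
    proof -
      have "(L / l - real N)\<^sup>2 \<le> 1\<^sup>2" using N by (intro power_mono) auto
      then have "l / 2 * (L / l - real N)\<^sup>2 \<le> l / 2" using l by simp
      moreover have "l * (real N * (real N + 1) / 2) - L * real N
          = l / 2 * (L / l - real N)\<^sup>2 - L\<^sup>2 / (2 * l) + l / 2 * real N"
        using l by (simp add: power2_eq_square field_simps)
      moreover have "l / 2 * real N \<le> L / 2" using N l by (simp add: field_simps)
      ultimately show ?thesis by linarith
    qed
    then have "t * (l * (real N * (real N + 1) / 2) - L * real N) \<le> t * (l / 2 - L\<^sup>2 / (2 * l) + L / 2)"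
      using assms by (intro mult_left_mono) auto
    ultimately show ?thesis by (simp add: algebra_simps)
  qed
  finally show ?thesis by simp
qed

lemma quadratic_dominates_linear:
  fixes \<kappa> a b :: real
  assumes "0 < \<kappa>" "0 \<le> a" "0 \<le> b"
  obtains \<delta> where "0 < \<delta>" "\<delta> < 1" "\<And>r. 0 < r \<Longrightarrow> r < \<delta> \<Longrightarrow> a * ln (1 / r) + b \<le> \<kappa> * (ln (1 / r))\<^sup>2"
proof -
  define c where "c = max 1 ((a + b) / \<kappa>)"
  have "a * ln (1 / r) + b \<le> \<kappa> * (ln (1 / r))\<^sup>2" if r: "0 < r" "r < exp (- c)" for r
  proof -
    have "ln r < - c" using r by (metis ln_exp ln_less_cancel_iff exp_gt_zero)
    then have L: "c \<le> ln (1 / r)" using r by (simp add: ln_div)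
    then have "1 \<le> ln (1 / r)" "a + b \<le> \<kappa> * ln (1 / r)"
      using assms by (auto simp: c_def field_simps)
    then have "a * ln (1 / r) + b * 1 \<le> a * ln (1 / r) + b * ln (1 / r)"
      using assms by (intro add_left_mono mult_left_mono) auto
    also have "\<dots> = (a + b) * ln (1 / r)" by (simp add: algebra_simps)
    also have "\<dots> \<le> \<kappa> * ln (1 / r) * ln (1 / r)"
      using \<open>1 \<le> _\<close> \<open>a + b \<le> _\<close> by (intro mult_right_mono) auto
    finally show ?thesis by (simp add: power2_eq_square mult.assoc)
  qed
  moreover have "exp (- c) < 1" by (simp add: c_def)
  ultimately show thesis using that[of "exp (- c)"] by simp
qed

context Metric_space
begin

text \<open>For small \<open>r\<close> the product \<open>P 0 r\<close> is at most the fine gauge with any parameter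
\<open>u < t / (2 * ln (1 / lam))\<close>, so the bound for covers of the cube transfers to the gauge.\<close>

lemma Lambda_HC_pos:
  assumes cs: "compact_space mtopology" and lam: "0 < lam" "lam < 1"
    and s: "Lambda M d (\<lambda>r. r powr s) M > 0" and t: "0 < t" "t < s" and u: "0 < u" "u < t / (2 * ln (1 / lam))"
  shows "Lambda (HC M) (HC_dist d (\<lambda>n. lam ^ n)) (fine_gauge u) (HC M) > 0"
proof -
  have tb: "mtotally_bounded M"
    using cs by (simp add: compact_space_eq_mcomplete_mtotally_bounded)
  then have bd: "mbounded M" by (rule mtotally_bounded_imp_mbounded)
  interpret H: Metric_space "HC M" "HC_dist d (\<lambda>n. lam ^ n)"
    by (rule Metric_space_HC_powers[OF cs lam])
  have "0 < s" using t by simp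
  obtain c where c: "0 < c" "content_ge s c"
    using Hausdorff_content_pos[OF s \<open>0 < s\<close>] by blast
  obtain K where K: "0 < K"
    "\<And>\<theta> w E b. 0 < \<theta> \<Longrightarrow> weighted_cover w E b \<theta> \<Longrightarrow> (\<And>i. b i \<le> 1) \<Longrightarrow>
       ennreal \<theta> \<le> ennreal K * (\<Sum>i. w i * ennreal (b i powr t))"
    by (rule weighted_content_le[OF tb c(2,1) t]) blast
  define C where "C = max 1 K"
  have C: "1 \<le> C" "K \<le> C" by (auto simp: C_def)
  define m where "m r = min 1 (C * r powr t)" for r
  define l where "l = ln (1 / lam)"
  have l: "0 < l" using lam by (simp add: l_def)
  define N where "N r = nat \<lfloor>ln (1 / r) / l\<rfloor>" for r
  define P where "P k r = (\<Prod>n\<in>{k<..N r}. m (r / lam ^ n))" for k r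
  have m1: "m (r / lam ^ n) = 1" if "0 < r" "N r < n" for r n
  proof -
    have "ln (1 / r) / l \<le> real n" using that(2) unfolding N_def by linarith
    then have "ln (1 / r) \<le> real n * l" using l by (simp add: field_simps)
    then have "0 \<le> ln (r / lam ^ n)" using that(1) lam by (simp add: l_def ln_div ln_realpow)
    then have "1 \<le> r / lam ^ n" using that(1) lam by (subst (asm) ln_ge_zero_iff) auto
    then have "1 \<le> (r / lam ^ n) powr t" using t by (intro ge_one_powr_ge_zero) auto
    then have "1 * 1 \<le> C * (r / lam ^ n) powr t" using C by (intro mult_mono) auto
    then show ?thesis by (simp add: m_def)
  qed
  define a where "a = ln C / l + t / 2"
  define b where "b = t * l / 2"
  define \<kappa> where "\<kappa> = t / (2 * l) - u"
  have ab: "0 \<le> a" "0 \<le> b" "0 < \<kappa>" using C l t u by (auto simp: a_def b_def \<kappa>_def l_def)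
  obtain \<delta> where \<delta>: "0 < \<delta>" "\<delta> < 1" "\<And>r. 0 < r \<Longrightarrow> r < \<delta> \<Longrightarrow> a * ln (1 / r) + b \<le> \<kappa> * (ln (1 / r))\<^sup>2"
    using quadratic_dominates_linear[OF ab(3,1,2)] by blast
  have P_le_fine: "P 0 r \<le> fine_gauge u r" if r: "0 < r" "r < \<delta>" for r
  proof -
    have "P 0 r \<le> exp (- (t / (2 * l)) * (ln (1 / r))\<^sup>2 + a * ln (1 / r) + b)"
      using product_of_truncated_powers_le[of lam C t r] lam C t r \<delta>(2)
      by (simp add: P_def m_def N_def l_def a_def b_def)
    also have "\<dots> \<le> exp (- (u * (ln (1 / r))\<^sup>2))"
      using \<delta>(3)[OF r] by (simp add: \<kappa>_def algebra_simps)
    finally show ?thesis using r by (simp add: fine_gauge_def)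
  qed
  define I where "I = (INF E \<in> {E :: nat \<Rightarrow> (nat \<Rightarrow> 'a) set. HC M \<subseteq> (\<Union>i. E i) \<and>
                 (\<forall>i. set_diam (HC_dist d (\<lambda>n. lam ^ n)) (E i) \<le> ennreal (\<delta> / 2) \<and> closedin H.mtopology (E i))}.
         \<Sum>i. ennreal (fine_gauge u (enn2real (set_diam (HC_dist d (\<lambda>n. lam ^ n)) (E i)))))"
  have "1 \<le> I" unfolding I_def
  proof (rule INF_greatest)
    fix E :: "nat \<Rightarrow> (nat \<Rightarrow> 'a) set"
    assume "E \<in> {E. HC M \<subseteq> (\<Union>i. E i) \<and>
                 (\<forall>i. set_diam (HC_dist d (\<lambda>n. lam ^ n)) (E i) \<le> ennreal (\<delta> / 2) \<and> closedin H.mtopology (E i))}"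
    then have E: "HC M \<subseteq> (\<Union>i. E i)" "\<And>i. set_diam (HC_dist d (\<lambda>n. lam ^ n)) (E i) \<le> ennreal (\<delta> / 2)"
      by auto
    define r where "r i = enn2real (set_diam (HC_dist d (\<lambda>n. lam ^ n)) (E i))" for i
    have fin: "set_diam (HC_dist d (\<lambda>n. lam ^ n)) (E i) < top" for i
      using E(2)[of i] ennreal_less_top by (rule le_less_trans)
    have r: "0 \<le> r i" "r i < \<delta>" for i
    proof -
      have "r i \<le> \<delta> / 2" unfolding r_def using \<delta>(1) E(2) by (intro enn2real_leI) auto
      then show "r i < \<delta>" using \<delta>(1) by simp
    qed (simp add: r_def)
    have dia: "HC_dist d (\<lambda>n. lam ^ n) x y \<le> r i" if "x \<in> E i" "y \<in> E i" for i x y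
    proof -
      have "ennreal (HC_dist d (\<lambda>n. lam ^ n) x y) \<le> ennreal (r i)"
        using le_set_diam[OF that, of "HC_dist d (\<lambda>n. lam ^ n)"] fin[of i] by (simp add: r_def)
      then show ?thesis using r by (simp add: ennreal_le_iff)
    qed
    show "1 \<le> (\<Sum>i. ennreal (fine_gauge u (enn2real (set_diam (HC_dist d (\<lambda>n. lam ^ n)) (E i)))))"
    proof (rule ennreal_le_epsilon)
      fix e :: real assume e: "0 < e"
      have "\<exists>r'. r i < r' \<and> r' < \<delta> \<and> fine_gauge u r' \<le> fine_gauge u (r i) + e * (1/2) ^ Suc i" for i
        using fine_gauge_slightly_larger[OF u(1) r(1)[of i] r(2)[of i], of "e * (1/2) ^ Suc i"] e by auto
      then obtain r' where r': "\<And>i. r i < r' i" "\<And>i. r' i < \<delta>" "\<And>i. fine_gauge u (r' i) \<le> fine_gauge u (r i) + e * (1/2) ^ Suc i"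
        by metis
      have r'0: "0 < r' i" for i using r(1)[of i] r'(1)[of i] by simp
      \<comment> \<open>The enlarged radii are positive, as the bound for covers of the cube requires.\<close>
      have "1 \<le> (\<Sum>i::nat. ennreal (P 0 (r' i)))"
      proof (rule HC_cover_sum_ge_1[OF lam bd _ _ _ _ _ E(1), where m = m and P = P and r = r'])
        show "1 \<le> (\<Sum>i. w i * ennreal (m (b i)))" if "weighted_cover w F b 1" for w F b
          unfolding m_def by (rule truncated_gauge_weighted_cover[OF K(2) t(1) C that])
        show "0 \<le> m r" for r using C by (simp add: m_def)
        then show "0 \<le> P k r" for k r unfolding P_def by (intro prod_nonneg) auto
        show "P k r = P (Suc k) r * m (r / lam ^ Suc k)" if "0 < r" for k r
        proof (cases "k < N r")
          case True
          then have "{k<..N r} = insert (Suc k) {Suc k<..N r}" by auto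
          then show ?thesis unfolding P_def by (simp add: mult.commute)
        next
          case False
          then show ?thesis using m1[OF that, of "Suc k"] by (simp add: P_def)
        qed
        show "\<exists>k. P k r = 1" for r by (rule exI[of _ "N r"]) (simp add: P_def)
        show "0 < r' i" for i by (rule r'0)
        show "HC_dist d (\<lambda>n. lam ^ n) x y \<le> r' i" if "x \<in> E i \<inter> HC M" "y \<in> E i \<inter> HC M" for i x y
          using dia[of x i y] that r'(1)[of i] by simp
      qed
      also have "\<dots> \<le> (\<Sum>i. ennreal (fine_gauge u (r i)) + ennreal (e * (1/2) ^ Suc i))"
      proof (intro suminf_le)
        fix i
        have "P 0 (r' i) \<le> fine_gauge u (r i) + e * (1/2) ^ Suc i"
          using P_le_fine[OF r'0 r'(2), of i] r'(3)[of i] by linarith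
        then have "ennreal (P 0 (r' i)) \<le> ennreal (fine_gauge u (r i) + e * (1/2) ^ Suc i)"
          by (rule ennreal_leI)
        also have "\<dots> = ennreal (fine_gauge u (r i)) + ennreal (e * (1/2) ^ Suc i)"
          using e by (intro ennreal_plus) (auto simp: fine_gauge_def)
        finally show "ennreal (P 0 (r' i)) \<le> ennreal (fine_gauge u (r i)) + ennreal (e * (1/2) ^ Suc i)" .
      qed auto
      also have "\<dots> = (\<Sum>i. ennreal (fine_gauge u (r i))) + (\<Sum>i. ennreal (e * (1/2) ^ Suc i))"
        by (rule suminf_add[symmetric]) auto
      also have "(\<Sum>i. ennreal (e * (1/2) ^ Suc i)) = ennreal (e * 1)"
        using e by (intro suminf_ennreal_eq sums_mult power_half_series) auto
      finally show "1 \<le> (\<Sum>i. ennreal (fine_gauge u (enn2real (set_diam (HC_dist d (\<lambda>n. lam ^ n)) (E i))))) + ennreal e"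
        by (simp add: r_def)
    qed
  qed
  moreover have "I \<le> Lambda (HC M) (HC_dist d (\<lambda>n. lam ^ n)) (fine_gauge u) (HC M)"
    unfolding Lambda_eq_SUP I_def using \<delta>(1) by (intro SUP_upper2[of "\<delta> / 2"]) auto
  ultimately show ?thesis using less_le_trans[OF zero_less_one] order_trans by blast
qed

end

section \<open>Covering numbers and the upper bound\<close>

context Metric_space
begin

lemma cover_num_le:
  assumes "finite C" "C \<subseteq> M" "A \<subseteq> (\<Union>x\<in>C. mball x \<epsilon>)"
  shows "cover_num M d A \<epsilon> \<le> card C"
  unfolding cover_num_def using assms by (intro Least_le exI[of _ C]) simp

lemma cover_num_attained:
  assumes "mtotally_bounded M" "0 < \<epsilon>"
  obtains C where "finite C" "C \<subseteq> M" "card C = cover_num M d M \<epsilon>" "M \<subseteq> (\<Union>x\<in>C. mball x \<epsilon>)"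
proof -
  obtain K where "finite K \<and> K \<subseteq> M \<and> M \<subseteq> (\<Union>x\<in>K. mball x \<epsilon>)"
    using assms unfolding mtotally_bounded_def by meson
  then have "\<exists>n C. finite C \<and> C \<subseteq> M \<and> card C = n \<and> M \<subseteq> (\<Union>x\<in>C. mball x \<epsilon>)"
    by (intro exI[of _ "card K"] exI[of _ K]) simp
  then have "\<exists>C. finite C \<and> C \<subseteq> M \<and> card C = cover_num M d M \<epsilon> \<and> M \<subseteq> (\<Union>x\<in>C. mball x \<epsilon>)"
    unfolding cover_num_def by (rule LeastI_ex)
  then show thesis using that by blast
qed

lemma cover_num_antimono:
  assumes "mtotally_bounded M" "0 < \<epsilon>" "\<epsilon> \<le> \<epsilon>'"
  shows "cover_num M d M \<epsilon>' \<le> cover_num M d M \<epsilon>"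
proof -
  obtain C where C: "finite C" "C \<subseteq> M" "card C = cover_num M d M \<epsilon>" "M \<subseteq> (\<Union>x\<in>C. mball x \<epsilon>)"
    using cover_num_attained[OF assms(1,2)] .
  have "M \<subseteq> (\<Union>x\<in>C. mball x \<epsilon>')"
    using C(4) mball_subset_concentric[OF assms(3)] by blast
  then show ?thesis unfolding C(3)[symmetric] by (rule cover_num_le[OF C(1,2)])
qed

text \<open>Balls of radius \<open>\<epsilon>\<close> have diameter up to \<open>2 * \<epsilon>\<close>. The factor \<open>2\<close> changes the exponent of the fine
gauge by a linear term in \<open>ln (1 / \<epsilon>)\<close> only, which any increase of the parameter outweighs.\<close>

lemma Lambda_fine_gauge_eq_0:
  assumes tb: "mtotally_bounded M" and u: "0 < u" "u < s"
    and lim: "Limsup (at_right 0) (\<lambda>\<epsilon>. ereal (real (cover_num M d M \<epsilon>) * fine_gauge u \<epsilon>)) < \<infinity>"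
  shows "Lambda M d (fine_gauge s) M = 0"
proof -
  obtain B :: real where "Limsup (at_right 0) (\<lambda>\<epsilon>. ereal (real (cover_num M d M \<epsilon>) * fine_gauge u \<epsilon>)) < ereal B"
    using less_PInf_Ex_of_nat[THEN iffD1, OF less_imp_neq[OF lim]] by blast
  then have evB: "\<forall>\<^sub>F \<epsilon> in at_right 0. real (cover_num M d M \<epsilon>) * fine_gauge u \<epsilon> < B"
    using Limsup_lessD by fastforce
  have ratio: "((\<lambda>\<epsilon>. exp (- (s * (ln (1 / (2 * \<epsilon>)))\<^sup>2)) / exp (- (u * (ln (1 / \<epsilon>))\<^sup>2))) \<longlongrightarrow> 0) (at_right (0::real))"
    using u by real_asymp
  define I where "I \<delta> = (INF E \<in> {E :: nat \<Rightarrow> 'a set. M \<subseteq> (\<Union>i. E i) \<and>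
                 (\<forall>i. set_diam d (E i) \<le> ennreal \<delta> \<and> closedin mtopology (E i))}.
         \<Sum>i. ennreal (fine_gauge s (enn2real (set_diam d (E i)))))" for \<delta>
  have "I \<delta> \<le> 0 + ennreal \<eta>" if "0 < \<delta>" "0 < \<eta>" for \<delta> \<eta>
  proof -
    define B' where "B' = max B 1"
    have "\<forall>\<^sub>F \<epsilon> in at_right 0. exp (- (s * (ln (1 / (2 * \<epsilon>)))\<^sup>2)) / exp (- (u * (ln (1 / \<epsilon>))\<^sup>2)) < \<eta> / B'"
      using ratio \<open>0 < \<eta>\<close> by (intro order_tendstoD) (auto simp: B'_def)
    moreover have "\<forall>\<^sub>F \<epsilon> in at_right 0. \<epsilon> \<in> {0<..<min (1/2) (\<delta>/2)}"
      using \<open>0 < \<delta>\<close> by (intro eventually_at_right_real) auto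
    ultimately have "\<forall>\<^sub>F \<epsilon> in at_right 0. real (cover_num M d M \<epsilon>) * fine_gauge u \<epsilon> < B \<and>
        exp (- (s * (ln (1 / (2 * \<epsilon>)))\<^sup>2)) / exp (- (u * (ln (1 / \<epsilon>))\<^sup>2)) < \<eta> / B' \<and> \<epsilon> \<in> {0<..<min (1/2) (\<delta>/2)}"
      using evB by eventually_elim auto
    then obtain \<epsilon> where \<epsilon>: "real (cover_num M d M \<epsilon>) * fine_gauge u \<epsilon> < B"
        "exp (- (s * (ln (1 / (2 * \<epsilon>)))\<^sup>2)) / exp (- (u * (ln (1 / \<epsilon>))\<^sup>2)) < \<eta> / B'" "\<epsilon> \<in> {0<..<min (1/2) (\<delta>/2)}"
      using eventually_happens[of _ "at_right (0::real)"] by (auto simp: trivial_limit_at_right_real)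
    have e0: "0 < \<epsilon>" "2 * \<epsilon> \<le> 1" "2 * \<epsilon> \<le> \<delta>" using \<epsilon>(3) by auto
    obtain C where C: "finite C" "C \<subseteq> M" "card C = cover_num M d M \<epsilon>" "M \<subseteq> (\<Union>x\<in>C. mball x \<epsilon>)"
      using cover_num_attained[OF tb e0(1)] .
    have "I \<delta> \<le> ennreal (real (card C) * fine_gauge s (2 * \<epsilon>))"
      unfolding I_def using u e0
      by (intro Lambda_le_card_cover[OF C(1,2,4)] fine_gauge_mono) auto
    also have "real (card C) * fine_gauge s (2 * \<epsilon>) \<le> \<eta>"
    proof -
      have "fine_gauge s (2 * \<epsilon>) \<le> fine_gauge u \<epsilon> * (\<eta> / B')"
        using \<epsilon>(2) e0 by (simp add: fine_gauge_def field_simps)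
      then have "real (card C) * fine_gauge s (2 * \<epsilon>) \<le> real (card C) * (fine_gauge u \<epsilon> * (\<eta> / B'))"
        by (intro mult_left_mono) auto
      also have "\<dots> = (real (cover_num M d M \<epsilon>) * fine_gauge u \<epsilon>) * (\<eta> / B')" by (simp add: C(3))
      also have "\<dots> \<le> B' * (\<eta> / B')"
        using \<epsilon>(1) \<open>0 < \<eta>\<close> by (intro mult_right_mono) (auto simp: B'_def)
      also have "\<dots> = \<eta>" by (simp add: B'_def)
      finally show ?thesis .
    qed
    finally show ?thesis by (simp add: ennreal_leI)
  qed
  then have "I \<delta> \<le> 0" if "0 < \<delta>" for \<delta> using that by - (rule ennreal_le_epsilon, blast)
  then have "(SUP \<delta>\<in>{0<..}. I \<delta>) \<le> 0" by (intro SUP_least) auto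
  then show ?thesis unfolding Lambda_eq_SUP I_def by simp
qed

lemma crit_le_upper_Minkowski_crit_fine:
  assumes tb: "mtotally_bounded M"
  shows "crit M d fine_scale M \<le> upper_Minkowski_crit M d fine_scale M"
proof -
  define P where "P = {s \<in> {0<..}. Lambda M d (fine_gauge s) M > 0}"
  define S where "S = {s \<in> {0<..}. Limsup (at_right 0) (\<lambda>\<epsilon>. ereal (real (cover_num M d M \<epsilon>) * fine_gauge s \<epsilon>)) < \<infinity>}"
  have crit: "crit M d fine_scale M = (if P = {} then Inf (ereal ` {0<..}) else Sup (ereal ` P))"
    unfolding crit_def fine_scale_eq P_def Let_def fst_conv snd_conv by (rule refl)
  have Mcrit: "upper_Minkowski_crit M d fine_scale M = (if S = {} then Sup (ereal ` {0<..}) else Inf (ereal ` S))"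
    unfolding upper_Minkowski_crit_def fine_scale_eq S_def Let_def fst_conv snd_conv by (rule refl)
  have le: "p \<le> s" if "p \<in> P" "s \<in> S" for p s
  proof (rule ccontr)
    assume "\<not> p \<le> s"
    then have "Lambda M d (fine_gauge p) M = 0"
      using that by (intro Lambda_fine_gauge_eq_0[OF tb, of s]) (auto simp: S_def)
    then show False using that(1) by (simp add: P_def)
  qed
  have sub: "P \<subseteq> {0<..}" "S \<subseteq> {0<..}" by (auto simp: P_def S_def)
  show ?thesis
  proof (cases "P = {}")
    case True
    then show ?thesis unfolding crit Mcrit using sub(2)
      by (auto intro!: Inf_superset_mono Inf_le_Sup)
  next
    case False
    then show ?thesis unfolding crit Mcrit using sub(1) le
      by (cases "S = {}") (simp_all add: Sup_subset_mono image_mono, auto intro!: Sup_least Inf_greatest)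
  qed
qed

text \<open>The net consists of the sequences whose first \<open>N\<close> coordinates run through nets of the factor, of mesh
\<open>a / lam ^ n\<close> in coordinate \<open>n\<close>, and whose other coordinates are a fixed point.\<close>

lemma HC_finite_cover:
  assumes tb: "mtotally_bounded M" and lam: "0 < lam" "lam < 1"
    and B: "\<And>x y. x \<in> M \<Longrightarrow> y \<in> M \<Longrightarrow> d x y \<le> B"
    and "0 < a" "0 < \<epsilon>" and small: "real N * a\<^sup>2 + B\<^sup>2 * (lam\<^sup>2) ^ (N + 1) / (1 - lam\<^sup>2) < \<epsilon>\<^sup>2"
  obtains D where "finite D" "D \<subseteq> HC M" "card D \<le> (\<Prod>n\<in>{1..N}. cover_num M d M (a / lam ^ n))"
    "\<And>x. x \<in> HC M \<Longrightarrow> \<exists>y\<in>D. HC_dist d (\<lambda>n. lam ^ n) y x < \<epsilon>"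
proof (cases "M = {}")
  case True
  then have "HC M = {}" by (auto simp: HC_def PiE_eq_empty_iff)
  then show thesis using that[of "{}"] by auto
next
  case False
  then obtain x0 where x0: "x0 \<in> M" by blast
  have "0 < a / lam ^ n" for n using \<open>0 < a\<close> lam by simp
  then have "\<exists>C. finite C \<and> C \<subseteq> M \<and> card C = cover_num M d M (a / lam ^ n) \<and> M \<subseteq> (\<Union>x\<in>C. mball x (a / lam ^ n))" for n
    by (rule cover_num_attained[OF tb]) blast
  then obtain C where C: "\<And>n. finite (C n)" "\<And>n. C n \<subseteq> M" "\<And>n. card (C n) = cover_num M d M (a / lam ^ n)"
    "\<And>n. M \<subseteq> (\<Union>x\<in>C n. mball x (a / lam ^ n))" by metis
  define ext where "ext p = restrict (\<lambda>n. if n \<le> N then p n else x0) {1..}" for p :: "nat \<Rightarrow> 'a"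
  define D where "D = ext ` (\<Pi>\<^sub>E n\<in>{1..N}. C n)"
  have extH: "ext p \<in> HC M" if p: "p \<in> (\<Pi>\<^sub>E n\<in>{1..N}. C n)" for p
  proof -
    have "p n \<in> M" if "1 \<le> n" "n \<le> N" for n using p C(2)[of n] that by (auto simp: PiE_iff)
    then show ?thesis using x0 unfolding HC_def ext_def by auto
  qed
  show thesis
  proof (rule that)
    show "finite D" unfolding D_def using C(1) by (intro finite_imageI finite_PiE) auto
    show "D \<subseteq> HC M" unfolding D_def using extH by blast
    have "card D \<le> card (\<Pi>\<^sub>E n\<in>{1..N}. C n)"
      unfolding D_def using C(1) by (intro card_image_le finite_PiE) auto
    also have "\<dots> = (\<Prod>n\<in>{1..N}. cover_num M d M (a / lam ^ n))" by (simp add: card_PiE C(3))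
    finally show "card D \<le> (\<Prod>n\<in>{1..N}. cover_num M d M (a / lam ^ n))" .
    fix x assume x: "x \<in> HC M"
    have "\<exists>c\<in>C n. d c (x n) < a / lam ^ n" if "1 \<le> n" for n
    proof -
      have "x n \<in> M" using x that by (auto simp: HC_def PiE_iff)
      then obtain c where "c \<in> C n" "x n \<in> mball c (a / lam ^ n)" using C(4)[of n] by blast
      then show ?thesis by auto
    qed
    then obtain c where c: "\<And>n. 1 \<le> n \<Longrightarrow> c n \<in> C n \<and> d (c n) (x n) < a / lam ^ n" by metis
    define p where "p = restrict c {1..N}"
    have p: "p \<in> (\<Pi>\<^sub>E n\<in>{1..N}. C n)" unfolding p_def using c by auto
    have "(HC_dist d (\<lambda>n. lam ^ n) (ext p) x)\<^sup>2 \<le> real N * a\<^sup>2 + B\<^sup>2 * (lam\<^sup>2) ^ (N + 1) / (1 - lam\<^sup>2)"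
    proof (rule HC_dist_le[OF lam extH[OF p] x B])
      fix n assume n: "1 \<le> n" "n \<le> N"
      then have "d (ext p n) (x n) < a / lam ^ n" using c[of n] by (simp add: ext_def p_def)
      then show "lam ^ n * d (ext p n) (x n) \<le> a" using lam by (simp add: field_simps)
    qed (use \<open>0 < a\<close> in auto)
    also have "\<dots> < \<epsilon>\<^sup>2" by (rule small)
    finally have "HC_dist d (\<lambda>n. lam ^ n) (ext p) x < \<epsilon>"
      using \<open>0 < \<epsilon>\<close> by (simp add: power2_less_imp_less)
    then show "\<exists>y\<in>D. HC_dist d (\<lambda>n. lam ^ n) y x < \<epsilon>" unfolding D_def using p by blast
  qed
qed

text \<open>With mesh \<open>\<epsilon> / (2 * N)\<close> the first \<open>N\<close> coordinates account for at most a quarter of \<open>\<epsilon>\<^sup>2\<close>;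
\<open>A\<close> is such that the others account for at most another quarter if \<open>lam ^ N * A \<le> \<epsilon>\<close>. Dividing by \<open>N\<close> is harmless
later, as it costs a factor \<open>(2 * N) powr (t * N)\<close>, whose logarithm is \<open>O(L * ln L)\<close>.\<close>

lemma HC_cover_num_le:
  assumes cs: "compact_space mtopology" and lam: "0 < lam" "lam < 1"
  obtains A where "1 \<le> A"
    "\<And>\<epsilon> N. 0 < \<epsilon> \<Longrightarrow> 1 \<le> N \<Longrightarrow> lam ^ N * A \<le> \<epsilon> \<Longrightarrow>
       cover_num (HC M) (HC_dist d (\<lambda>n. lam ^ n)) (HC M) \<epsilon>
         \<le> (\<Prod>n\<in>{1..N}. cover_num M d M (\<epsilon> / (2 * real N) / lam ^ n))"
    "Metric_space.mtotally_bounded (HC M) (HC_dist d (\<lambda>n. lam ^ n)) (HC M)"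
proof -
  have tb: "mtotally_bounded M"
    using cs by (simp add: compact_space_eq_mcomplete_mtotally_bounded)
  interpret H: Metric_space "HC M" "HC_dist d (\<lambda>n. lam ^ n)"
    by (rule Metric_space_HC_powers[OF cs lam])
  obtain B where B: "\<And>x y. x \<in> M \<Longrightarrow> y \<in> M \<Longrightarrow> d x y \<le> B"
    using mtotally_bounded_imp_mbounded[OF tb] unfolding mbounded_alt by blast
  have lam2: "0 < lam\<^sup>2" "lam\<^sup>2 < 1" using lam by (auto simp: power_less_one_iff)
  define Q where "Q = B\<^sup>2 * lam\<^sup>2 / (1 - lam\<^sup>2)"
  define A where "A = max 1 (2 * sqrt Q)"
  have Q: "0 \<le> Q" using lam2 by (simp add: Q_def)
  have "2 * sqrt Q \<le> A" by (simp add: A_def)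
  then have "(2 * sqrt Q)\<^sup>2 \<le> A\<^sup>2" using Q by (intro power_mono) auto
  then have A: "1 \<le> A" "4 * Q \<le> A\<^sup>2" using Q by (auto simp: A_def power_mult_distrib)
  have cover: "\<exists>D. finite D \<and> D \<subseteq> HC M \<and> card D \<le> (\<Prod>n\<in>{1..N}. cover_num M d M (\<epsilon> / (2 * real N) / lam ^ n)) \<and>
      HC M \<subseteq> (\<Union>x\<in>D. H.mball x \<epsilon>)" if e: "0 < \<epsilon>" "1 \<le> N" "lam ^ N * A \<le> \<epsilon>" for \<epsilon> N
  proof -
    define a where "a = \<epsilon> / (2 * real N)"
    have "real N * a\<^sup>2 \<le> \<epsilon>\<^sup>2 / 4"
      using e by (simp add: a_def power2_eq_square divide_simps)
    moreover have "B\<^sup>2 * (lam\<^sup>2) ^ (N + 1) / (1 - lam\<^sup>2) \<le> \<epsilon>\<^sup>2 / 4"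
    proof -
      have "(lam ^ N * A)\<^sup>2 \<le> \<epsilon>\<^sup>2" using e lam A by (intro power_mono) auto
      moreover have "B\<^sup>2 * (lam\<^sup>2) ^ (N + 1) / (1 - lam\<^sup>2) = (lam ^ N)\<^sup>2 * Q"
        by (simp add: Q_def mult_ac flip: power_mult)
      moreover have "(lam ^ N)\<^sup>2 * (4 * Q) \<le> (lam ^ N)\<^sup>2 * A\<^sup>2" using A by (intro mult_left_mono) auto
      ultimately show ?thesis by (simp add: power_mult_distrib)
    qed
    moreover have "0 < \<epsilon>\<^sup>2" using e by simp
    ultimately have small: "real N * a\<^sup>2 + B\<^sup>2 * (lam\<^sup>2) ^ (N + 1) / (1 - lam\<^sup>2) < \<epsilon>\<^sup>2" by linarith
    have "0 < a" using e by (simp add: a_def)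
    show ?thesis
    proof (rule HC_finite_cover[OF tb lam B \<open>0 < a\<close> e(1) small])
      fix D assume D: "finite D" "D \<subseteq> HC M" "card D \<le> (\<Prod>n\<in>{1..N}. cover_num M d M (a / lam ^ n))"
        "\<And>x. x \<in> HC M \<Longrightarrow> \<exists>y\<in>D. HC_dist d (\<lambda>n. lam ^ n) y x < \<epsilon>"
      have "HC M \<subseteq> (\<Union>x\<in>D. H.mball x \<epsilon>)"
      proof
        fix x assume x: "x \<in> HC M"
        then obtain y where "y \<in> D" "HC_dist d (\<lambda>n. lam ^ n) y x < \<epsilon>" using D(4) by blast
        then have "x \<in> H.mball y \<epsilon>" using x D(2) by auto
        then show "x \<in> (\<Union>x\<in>D. H.mball x \<epsilon>)" using \<open>y \<in> D\<close> by blast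
      qed
      then show ?thesis using D(1-3) unfolding a_def by (intro exI[of _ D]) simp
    qed simp_all
  qed
  show thesis
  proof (rule that[OF A(1)])
    fix \<epsilon> N assume e: "0 < \<epsilon>" "(1::nat) \<le> N" "lam ^ N * A \<le> \<epsilon>"
    obtain D where D: "finite D" "D \<subseteq> HC M" "HC M \<subseteq> (\<Union>x\<in>D. H.mball x \<epsilon>)"
        "card D \<le> (\<Prod>n\<in>{1..N}. cover_num M d M (\<epsilon> / (2 * real N) / lam ^ n))"
      using cover[OF e] by blast
    show "cover_num (HC M) (HC_dist d (\<lambda>n. lam ^ n)) (HC M) \<epsilon>
         \<le> (\<Prod>n\<in>{1..N}. cover_num M d M (\<epsilon> / (2 * real N) / lam ^ n))"
      using H.cover_num_le[OF D(1-3)] D(4) by (rule order_trans)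
  next
    show "H.mtotally_bounded (HC M)" unfolding H.mtotally_bounded_def
    proof (intro allI impI)
      fix \<epsilon> :: real assume e: "0 < \<epsilon>"
      obtain N where N: "lam ^ N < \<epsilon> / A" using real_arch_pow_inv[of "\<epsilon> / A" lam] e A lam by auto
      have "lam ^ Suc N \<le> lam ^ N" using lam by (intro power_decreasing) auto
      then have "lam ^ Suc N \<le> \<epsilon> / A" using N by linarith
      then have "lam ^ Suc N * A \<le> \<epsilon>" using A by (simp add: field_simps)
      then show "\<exists>K. finite K \<and> K \<subseteq> HC M \<and> HC M \<subseteq> (\<Union>x\<in>K. H.mball x \<epsilon>)"
        using cover[OF e, of "Suc N"] by (simp del: power_Suc) blast
    qed
  qed
qed

text \<open>The upper Minkowski dimension controls small radii only. Larger ones up to \<open>R\<close> are absorbed into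
the constant, since covering numbers decrease with the radius.\<close>

lemma cover_num_powr_bound:
  assumes tb: "mtotally_bounded M" and t: "upper_Minkowski_dim M d M < ereal t" "0 \<le> t" and "0 < R"
  obtains C where "1 \<le> C" "\<And>r. 0 < r \<Longrightarrow> r \<le> R \<Longrightarrow> real (cover_num M d M r) \<le> C * (1 / r) powr t"
proof -
  have "\<forall>\<^sub>F \<epsilon> in at_right 0. ereal (ln (real (cover_num M d M \<epsilon>)) / ln (1 / \<epsilon>)) < ereal t"
    using t(1) unfolding upper_Minkowski_dim_def by (rule Limsup_lessD)
  then obtain b where b: "0 < b" "\<And>\<epsilon>. 0 < \<epsilon> \<Longrightarrow> \<epsilon> < b \<Longrightarrow> ln (real (cover_num M d M \<epsilon>)) / ln (1 / \<epsilon>) < t"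
    by (auto simp: eventually_at_right_field)
  define r0 where "r0 = min (b / 2) (1 / 2)"
  have r0: "0 < r0" "r0 < b" "r0 < 1" using b by (auto simp: r0_def)
  define C where "C = max 1 (real (cover_num M d M r0) * R powr t)"
  have "real (cover_num M d M r) \<le> C * (1 / r) powr t" if r: "0 < r" "r \<le> R" for r
  proof (cases "r \<le> r0")
    case True
    show ?thesis
    proof (cases "cover_num M d M r = 0")
      case False
      have "0 < ln (1 / r)" using r True r0 by simp
      then have "ln (real (cover_num M d M r)) < t * ln (1 / r)"
        using b(2)[of r] r True r0 by (simp add: field_simps)
      then have "real (cover_num M d M r) \<le> (1 / r) powr t"
        using False r exp_less_mono[of "ln (real (cover_num M d M r))" "t * ln (1 / r)"]
        by (simp add: powr_def)
      also have "\<dots> \<le> C * (1 / r) powr t" by (simp add: C_def mult_le_cancel_right1)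
      finally show ?thesis .
    qed (auto simp: C_def)
  next
    case False
    have "real (cover_num M d M r) \<le> real (cover_num M d M r0)"
      using cover_num_antimono[OF tb r0(1), of r] False by simp
    also have "\<dots> * 1 \<le> real (cover_num M d M r0) * (R powr t * (1 / r) powr t)"
    proof (rule mult_left_mono)
      have "1 \<le> R / r" using r by simp
      then have "1 \<le> (R / r) powr t" using t by (intro ge_one_powr_ge_zero) auto
      then show "1 \<le> R powr t * (1 / r) powr t" using r \<open>0 < R\<close> by (simp flip: powr_mult)
    qed simp
    also have "\<dots> \<le> C * (1 / r) powr t"
      unfolding mult.assoc[symmetric] by (intro mult_right_mono) (auto simp: C_def)
    finally show ?thesis by simp
  qed
  then show thesis using that[of C] by (simp add: C_def)
qed

text \<open>With \<open>N\<close> the least number of coordinates satisfying \<open>lam ^ N * A \<le> \<epsilon>\<close>, the logarithm of the product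
of covering numbers is at most \<open>t * L\<^sup>2 / (2 * l)\<close> plus a term of order \<open>L * ln L\<close>, and
\<open>u * L\<^sup>2\<close> exceeds both together for small \<open>\<epsilon>\<close>.\<close>

lemma HC_cover_num_fine_bounded:
  assumes cs: "compact_space mtopology" and lam: "0 < lam" "lam < 1"
    and t: "upper_Minkowski_dim M d M < ereal t" "0 < t" and u: "t / (2 * ln (1 / lam)) < u"
  shows "Limsup (at_right 0) (\<lambda>\<epsilon>. ereal (real (cover_num (HC M) (HC_dist d (\<lambda>n. lam ^ n)) (HC M) \<epsilon>) * fine_gauge u \<epsilon>)) < \<infinity>"
proof -
  have tb: "mtotally_bounded M"
    using cs by (simp add: compact_space_eq_mcomplete_mtotally_bounded)
  obtain A where A: "1 \<le> A"
    "\<And>\<epsilon> N. 0 < \<epsilon> \<Longrightarrow> 1 \<le> N \<Longrightarrow> lam ^ N * A \<le> \<epsilon> \<Longrightarrow>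
       cover_num (HC M) (HC_dist d (\<lambda>n. lam ^ n)) (HC M) \<epsilon>
         \<le> (\<Prod>n\<in>{1..N}. cover_num M d M (\<epsilon> / (2 * real N) / lam ^ n))"
    by (rule HC_cover_num_le[OF cs lam]) blast
  have "0 < A / lam" using A lam by simp
  obtain C where C: "1 \<le> C" "\<And>r. 0 < r \<Longrightarrow> r \<le> A / lam \<Longrightarrow> real (cover_num M d M r) \<le> C * (1 / r) powr t"
    using cover_num_powr_bound[OF tb t(1) less_imp_le[OF t(2)] \<open>0 < A / lam\<close>] by blast
  define l where "l = ln (1 / lam)"
  define c where "c = ln A / l + 1"
  \<comment> \<open>Adding 1 makes the coefficient positive, which settles all signs in the asymptotics.\<close>
  define G where "G = ln C + 1"
  define \<kappa> where "\<kappa> = u - t / (2 * l)"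
  have l: "0 < l" and G: "0 < G" and \<kappa>: "0 < \<kappa>" using lam C u by (auto simp: l_def G_def \<kappa>_def add_nonneg_pos)
  have c: "1 \<le> c" using l A by (simp add: c_def)
  have "filterlim (\<lambda>L. - \<kappa> * L\<^sup>2 + (L / l + c) * (G + t * ln (2 * (L / l + c)))) at_bot at_top"
    using l G \<kappa> c t by real_asymp
  then have "\<forall>\<^sub>F L in at_top. - \<kappa> * L\<^sup>2 + (L / l + c) * (G + t * ln (2 * (L / l + c))) \<le> 0"
    by (rule filterlim_at_bot[THEN iffD1, rule_format])
  moreover have "filterlim (\<lambda>\<epsilon>::real. ln (1 / \<epsilon>)) at_top (at_right 0)" by real_asymp
  ultimately have "\<forall>\<^sub>F \<epsilon> in at_right 0. - \<kappa> * (ln (1 / \<epsilon>))\<^sup>2 + (ln (1 / \<epsilon>) / l + c) * (G + t * ln (2 * (ln (1 / \<epsilon>) / l + c))) \<le> 0"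
    by (rule eventually_compose_filterlim)
  moreover have "\<forall>\<^sub>F \<epsilon> in at_right 0. \<epsilon> \<in> {0<..<1::real}" by (rule eventually_at_right_real) simp
  ultimately have "\<forall>\<^sub>F \<epsilon> in at_right 0. ereal (real (cover_num (HC M) (HC_dist d (\<lambda>n. lam ^ n)) (HC M) \<epsilon>) * fine_gauge u \<epsilon>) \<le> 1"
  proof eventually_elim
    case (elim \<epsilon>)
    define L where "L = ln (1 / \<epsilon>)"
    have e: "0 < \<epsilon>" "\<epsilon> < 1" and L: "0 < L" using elim(2) by (auto simp: L_def)
    define N where "N = nat \<lceil>(L + ln A) / l\<rceil>"
    have pos: "0 < (L + ln A) / l" using L l A by (simp add: add_pos_nonneg)
    then have "0 < \<lceil>(L + ln A) / l\<rceil>" by (simp only: zero_less_ceiling)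
    then have "real N = of_int \<lceil>(L + ln A) / l\<rceil>" "1 \<le> N" unfolding N_def by linarith+
    then have N: "1 \<le> N" "(L + ln A) / l \<le> real N" "real N \<le> L / l + c"
      by (auto simp: c_def add_divide_distrib) linarith+
    have lamN: "lam ^ n = exp (- (real n * l))" for n
      using lam by (simp add: l_def ln_div exp_of_nat_mult[symmetric] mult.commute flip: powr_realpow) (simp add: powr_def)
    have epsL: "\<epsilon> = exp (- L)" using e by (simp add: L_def ln_div)
    have AE: "A = exp (ln A)" using A by simp
    have "lam ^ N * A \<le> \<epsilon>"
    proof -
      have "L + ln A \<le> real N * l" using N(2) l by (simp add: field_simps)
      then have "exp (- (real N * l) + ln A) \<le> exp (- L)" by (subst exp_le_cancel_iff) linarith
      moreover have "exp (- (real N * l) + ln A) = lam ^ N * A" unfolding lamN exp_add AE[symmetric] ..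
      ultimately show ?thesis by (simp only: epsL)
    qed
    then have "real (cover_num (HC M) (HC_dist d (\<lambda>n. lam ^ n)) (HC M) \<epsilon>)
        \<le> real (\<Prod>n\<in>{1..N}. cover_num M d M (\<epsilon> / (2 * real N) / lam ^ n))"
      using A(2)[OF e(1) N(1)] by (simp only: of_nat_le_iff)
    also have "\<dots> = (\<Prod>n\<in>{1..N}. real (cover_num M d M (\<epsilon> / (2 * real N) / lam ^ n)))" by simp
    also have "\<dots> \<le> (\<Prod>n\<in>{1..N}. exp (ln C + t * (L + ln (2 * real N) - real n * l)))"
    proof (rule prod_mono)
      fix n assume n: "n \<in> {1..N}"
      define r where "r = \<epsilon> / (2 * real N) / lam ^ n"
      have r0: "0 < r" using e N lam by (simp add: r_def)
      \<comment> \<open>As N is minimal, the meshes stay below a bound independent of the radius of the balls.\<close>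
      have "r \<le> A / lam"
      proof -
        have "real N * l \<le> L + ln A + l" using N(3) l by (simp add: c_def field_simps)
        moreover have "real n * l \<le> real N * l" using n l by simp
        ultimately have "exp (- L + real n * l) \<le> exp (ln A + real 1 * l)"
          by (subst exp_le_cancel_iff) simp
        moreover have "exp (- L + real n * l) = \<epsilon> / lam ^ n" "exp (ln A + real 1 * l) = A / lam ^ 1"
          unfolding lamN epsL exp_add AE[symmetric] by (simp_all only: exp_minus divide_inverse inverse_inverse_eq)
        ultimately have "\<epsilon> / lam ^ n \<le> A / lam ^ 1" by (simp only:)
        moreover have "r \<le> \<epsilon> / lam ^ n"
        proof -
          have "1 \<le> 2 * real N" using N(1) by simp
          then have "\<epsilon> / (2 * real N) \<le> \<epsilon> / 1" using e by (intro divide_left_mono) auto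
          then have "\<epsilon> / (2 * real N) / lam ^ n \<le> \<epsilon> / 1 / lam ^ n"
            by (rule divide_right_mono) (use lam in simp)
          then show ?thesis by (simp add: r_def)
        qed
        ultimately show ?thesis by simp
      qed
      then have "real (cover_num M d M r) \<le> C * (1 / r) powr t" using C(2) r0 by simp
      also have "\<dots> = exp (ln C + t * (L + ln (2 * real N) - real n * l))"
      proof -
        have "ln (1 / r) = L + ln (2 * real N) - real n * l"
          using e N lam by (simp add: r_def L_def l_def ln_div ln_mult ln_realpow)
        then show ?thesis using C r0 by (simp add: powr_def exp_add)
      qed
      finally show "0 \<le> real (cover_num M d M (\<epsilon> / (2 * real N) / lam ^ n)) \<and>
          real (cover_num M d M (\<epsilon> / (2 * real N) / lam ^ n)) \<le> exp (ln C + t * (L + ln (2 * real N) - real n * l))"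
        by (simp add: r_def)
    qed
    also have "\<dots> = exp (\<Sum>n\<in>{1..N}. ln C + t * (L + ln (2 * real N) - real n * l))"
      by (simp add: exp_sum)
    also have "(\<Sum>n\<in>{1..N}. ln C + t * (L + ln (2 * real N) - real n * l))
        = real N * (ln C + t * ln (2 * real N)) + t * (real N * L - l * (real N * (real N + 1) / 2))"
    proof -
      have "(\<Sum>n\<in>{1..m}. q - p * real n) = real m * q - p * (real m * (real m + 1) / 2)" for m and p q :: real
        by (induction m) (auto simp: field_simps)
      from this[of "ln C + t * (L + ln (2 * real N))" "t * l" N] show ?thesis by (simp add: algebra_simps)
    qed
    also have "\<dots> \<le> (L / l + c) * (G + t * ln (2 * (L / l + c))) + t * (L\<^sup>2 / (2 * l))"
    proof (rule add_mono)
      have "ln (2 * real N) \<le> ln (2 * (L / l + c))" using N by simp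
      then have "t * ln (2 * real N) \<le> t * ln (2 * (L / l + c))" using t by (intro mult_left_mono) auto
      then have "ln C + t * ln (2 * real N) \<le> G + t * ln (2 * (L / l + c))" by (simp add: G_def)
      moreover have "0 \<le> ln C + t * ln (2 * real N)" using C t N by simp
      ultimately show "real N * (ln C + t * ln (2 * real N)) \<le> (L / l + c) * (G + t * ln (2 * (L / l + c)))"
        using N by (intro mult_mono) auto
      have "0 \<le> l / 2 * (real N - L / l)\<^sup>2 + l / 2 * real N" using l by simp
      moreover have "real N * L - l * (real N * (real N + 1) / 2)
          = L\<^sup>2 / (2 * l) - (l / 2 * (real N - L / l)\<^sup>2 + l / 2 * real N)"
        using l by (simp add: power2_eq_square field_simps)
      ultimately have "real N * L - l * (real N * (real N + 1) / 2) \<le> L\<^sup>2 / (2 * l)" by linarith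
      then show "t * (real N * L - l * (real N * (real N + 1) / 2)) \<le> t * (L\<^sup>2 / (2 * l))"
        using t by (intro mult_left_mono) auto
    qed
    also have "\<dots> \<le> u * L\<^sup>2"
      using elim(1) by (simp add: L_def[symmetric] \<kappa>_def algebra_simps)
    finally have "real (cover_num (HC M) (HC_dist d (\<lambda>n. lam ^ n)) (HC M) \<epsilon>) \<le> exp (u * L\<^sup>2)" by simp
    then have "real (cover_num (HC M) (HC_dist d (\<lambda>n. lam ^ n)) (HC M) \<epsilon>) * exp (- (u * L\<^sup>2)) \<le> exp (u * L\<^sup>2) * exp (- (u * L\<^sup>2))"
      by (rule mult_right_mono) simp
    also have "\<dots> = 1" by (simp flip: exp_add)
    finally show ?case using e by (simp add: fine_gauge_def L_def one_ereal_def)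
  qed
  then have "Limsup (at_right 0) (\<lambda>\<epsilon>. ereal (real (cover_num (HC M) (HC_dist d (\<lambda>n. lam ^ n)) (HC M) \<epsilon>) * fine_gauge u \<epsilon>)) \<le> 1"
    by (rule Limsup_bounded)
  also have "(1::ereal) < \<infinity>" by simp
  finally show ?thesis .
qed

end

section \<open>Critical parameters\<close>

lemma coarse_gauge_eventually_ge_fine:
  assumes "s < 2" "0 < u"
  shows "\<forall>\<^sub>F r in at_right 0. fine_gauge u r \<le> snd coarse_scale s r"
proof -
  have "\<forall>\<^sub>F L in at_top. L powr s \<le> u * L\<^sup>2"
    using assms by real_asymp
  moreover have "filterlim (\<lambda>r::real. ln (1 / r)) at_top (at_right 0)" by real_asymp
  ultimately have "\<forall>\<^sub>F r in at_right 0. ln (1 / r) powr s \<le> u * (ln (1 / r))\<^sup>2"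
    by (rule eventually_compose_filterlim)
  then show ?thesis by eventually_elim (simp add: fine_gauge_def coarse_scale_def)
qed

lemma coarse_gauge_eventually_le_fine:
  assumes "2 < s"
  shows "\<forall>\<^sub>F r in at_right 0. snd coarse_scale s r \<le> fine_gauge u r"
proof -
  have "\<forall>\<^sub>F L in at_top. u * L\<^sup>2 \<le> L powr s"
  proof -
    have "\<forall>\<^sub>F L in at_top. (\<bar>u\<bar> + 1) * L\<^sup>2 \<le> L powr s"
      using assms by real_asymp
    then show ?thesis
    proof eventually_elim
      case (elim L)
      have "u * L\<^sup>2 \<le> (\<bar>u\<bar> + 1) * L\<^sup>2" by (intro mult_right_mono) auto
      then show ?case using elim by linarith
    qed
  qed
  moreover have "filterlim (\<lambda>r::real. ln (1 / r)) at_top (at_right 0)" by real_asymp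
  ultimately have "\<forall>\<^sub>F r in at_right 0. u * (ln (1 / r))\<^sup>2 \<le> ln (1 / r) powr s"
    by (rule eventually_compose_filterlim)
  then show ?thesis by eventually_elim (simp add: fine_gauge_def coarse_scale_def)
qed

text \<open>Some fine gauge gives positive measure and some other gives measure zero. Coarse gauges with
\<open>s < 2\<close> dominate the former, and coarse gauges with \<open>s > 2\<close> are dominated by the latter.\<close>

lemma crit_eq_2_coarse:
  assumes "0 < crit M d fine_scale A" "crit M d fine_scale A < \<infinity>"
  shows "crit M d coarse_scale A = 2"
proof -
  define f where "f = snd coarse_scale"
  have f0: "f s 0 = 0" for s by (simp add: f_def coarse_scale_def)
  define P where "P = {s \<in> {0<..}. Lambda M d (fine_gauge s) A > 0}"
  define S where "S = {s \<in> {1..}. Lambda M d (f s) A > 0}"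
  have fine: "crit M d fine_scale A = (if P = {} then Inf (ereal ` {0<..}) else Sup (ereal ` P))"
    unfolding crit_def fine_scale_eq P_def Let_def fst_conv snd_conv by (rule refl)
  have coarse: "crit M d coarse_scale A = (if S = {} then Inf (ereal ` {1..}) else Sup (ereal ` S))"
  proof -
    have "fst coarse_scale = {1..}" by (simp add: coarse_scale_def)
    then show ?thesis unfolding crit_def S_def Let_def f_def by (simp only:)
  qed
  have "P \<noteq> {}"
  proof
    assume "P = {}"
    moreover obtain x where "0 < ereal x" "ereal x < crit M d fine_scale A"
      using ereal_dense2[OF assms(1)] by blast
    moreover have "Inf (ereal ` {0<..}) \<le> ereal x" using \<open>0 < ereal x\<close> by (intro Inf_lower) auto
    ultimately show False unfolding fine by simp
  qed
  then obtain u where u: "u \<in> P" by blast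
  obtain v where v: "crit M d fine_scale A < ereal v"
    using ereal_dense2[OF assms(2)] by blast
  have "0 < v" using order.strict_trans[OF assms(1) v] by simp
  have "v \<notin> P"
  proof
    assume "v \<in> P"
    then have "ereal v \<le> crit M d fine_scale A" unfolding fine by (auto intro: Sup_upper)
    then show False using v by simp
  qed
  then have v0: "Lambda M d (fine_gauge v) A = 0" using \<open>0 < v\<close> by (simp add: P_def zero_less_iff_neq_zero)
  have low: "s \<in> S" if "1 \<le> s" "s < 2" for s
  proof -
    have "Lambda M d (fine_gauge u) A \<le> Lambda M d (f s) A"
      unfolding f_def using u that by (intro Lambda_mono coarse_gauge_eventually_ge_fine) (auto simp: P_def coarse_scale_def)
    then show ?thesis using u that by (auto simp: S_def P_def)
  qed
  have high: "s \<le> 2" if "s \<in> S" for s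
  proof (rule ccontr)
    assume "\<not> s \<le> 2"
    then have "Lambda M d (f s) A \<le> Lambda M d (fine_gauge v) A"
      unfolding f_def by (intro Lambda_mono coarse_gauge_eventually_le_fine) (auto simp: coarse_scale_def)
    then show False using that v0 by (simp add: S_def)
  qed
  have "S \<noteq> {}" using low[of 1] by auto
  have "Sup (ereal ` S) = ereal 2"
  proof (rule antisym)
    show "Sup (ereal ` S) \<le> ereal 2" using high by (intro Sup_least) auto
    show "ereal 2 \<le> Sup (ereal ` S)"
    proof (rule ccontr)
      assume "\<not> ereal 2 \<le> Sup (ereal ` S)"
      then obtain s where s: "Sup (ereal ` S) < ereal s" "ereal s < ereal 2"
        using ereal_dense2[of "Sup (ereal ` S)" "ereal 2"] by (auto simp: not_le)
      have "max s 1 \<in> S" using s by (intro low) auto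
      then have "ereal (max s 1) \<le> Sup (ereal ` S)" by (intro Sup_upper imageI)
      moreover have "ereal s \<le> ereal (max s 1)" by simp
      ultimately have "ereal s \<le> Sup (ereal ` S)" by (rule order_trans[rotated])
      then show False using s(1) by simp
    qed
  qed
  then show ?thesis unfolding coarse using \<open>S \<noteq> {}\<close> by simp
qed

context Metric_space
begin

text \<open>Parameters \<open>u\<close> with \<open>2 * l * u\<close> below the Hausdorff dimension leave room for the two exponents
\<open>2 * l * u < t < s\<close> that \<open>Lambda_HC_pos\<close> needs.\<close>

lemma crit_fine_HC_ge:
  assumes cs: "compact_space mtopology" and lam: "0 < lam" "lam < 1"
  shows "Hausdorff_dim M d M / ereal (2 * ln (1 / lam)) \<le> crit (HC M) (HC_dist d (\<lambda>n. lam ^ n)) fine_scale (HC M)"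
proof (rule ccontr)
  define l where "l = ln (1 / lam)"
  have l: "0 < l" using lam by (simp add: l_def)
  define P where "P = {s \<in> {0<..}. Lambda (HC M) (HC_dist d (\<lambda>n. lam ^ n)) (fine_gauge s) (HC M) > 0}"
  define S where "S = {s \<in> {0<..}. Lambda M d (\<lambda>r. r powr s) M > 0}"
  have fine: "crit (HC M) (HC_dist d (\<lambda>n. lam ^ n)) fine_scale (HC M) = (if P = {} then Inf (ereal ` {0<..}) else Sup (ereal ` P))"
    unfolding crit_def fine_scale_eq P_def Let_def fst_conv snd_conv by (rule refl)
  have dim: "Hausdorff_dim M d M = (if S = {} then Inf (ereal ` {0<..}) else Sup (ereal ` S))"
    unfolding Hausdorff_dim_def crit_def S_def Let_def fst_conv snd_conv by (rule refl)
  have nonneg: "0 \<le> crit (HC M) (HC_dist d (\<lambda>n. lam ^ n)) fine_scale (HC M)"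
  proof (cases "P = {}")
    case True
    then show ?thesis unfolding fine by (auto intro!: Inf_greatest)
  next
    case False
    then obtain p where "p \<in> P" by blast
    then have "0 \<le> ereal p" "ereal p \<le> Sup (ereal ` P)" by (auto simp: P_def intro: Sup_upper)
    then have "0 \<le> Sup (ereal ` P)" by (rule order_trans)
    then show ?thesis unfolding fine using False by simp
  qed
  assume "\<not> ?thesis"
  then have "crit (HC M) (HC_dist d (\<lambda>n. lam ^ n)) fine_scale (HC M) < Hausdorff_dim M d M / ereal (2 * l)"
    by (simp only: l_def not_le)
  then obtain u where u: "crit (HC M) (HC_dist d (\<lambda>n. lam ^ n)) fine_scale (HC M) < ereal u"
      "ereal u < Hausdorff_dim M d M / ereal (2 * l)"
    using ereal_dense2 by blast
  have "0 < u" using le_less_trans[OF nonneg u(1)] by simp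
  have "ereal (2 * l) * ereal u < Hausdorff_dim M d M"
    using u(2) l by (subst (asm) ereal_less_divide_pos) auto
  then have big: "ereal (2 * l * u) < Hausdorff_dim M d M" by simp
  have "S \<noteq> {}"
  proof
    assume "S = {}"
    have "Inf (ereal ` {0<..}) \<le> ereal (2 * l * u)" using l \<open>0 < u\<close> by (intro Inf_lower) auto
    then show False using big \<open>S = {}\<close> by (simp add: dim)
  qed
  then obtain s where s: "s \<in> S" "2 * l * u < s" using big by (auto simp: dim less_Sup_iff)
  define t where "t = (2 * l * u + s) / 2"
  have t: "2 * l * u < t" "t < s" using s by (auto simp: t_def)
  have "0 < 2 * l * u" using l \<open>0 < u\<close> by simp
  then have "0 < t" using t by linarith
  have "u < t / (2 * l)" using t l by (simp add: field_simps)
  then have "Lambda (HC M) (HC_dist d (\<lambda>n. lam ^ n)) (fine_gauge u) (HC M) > 0"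
    using s \<open>0 < t\<close> t \<open>0 < u\<close> by (intro Lambda_HC_pos[OF cs lam, of s t]) (auto simp: S_def l_def)
  then have "u \<in> P" using \<open>0 < u\<close> by (simp add: P_def)
  then have "ereal u \<le> crit (HC M) (HC_dist d (\<lambda>n. lam ^ n)) fine_scale (HC M)"
    unfolding fine by (auto intro: Sup_upper)
  then show False using u(1) by simp
qed

lemma upper_Minkowski_crit_fine_HC_le:
  assumes cs: "compact_space mtopology" and lam: "0 < lam" "lam < 1"
  shows "upper_Minkowski_crit (HC M) (HC_dist d (\<lambda>n. lam ^ n)) fine_scale (HC M)
           \<le> upper_Minkowski_dim M d M / ereal (2 * ln (1 / lam))"
proof (rule ccontr)
  define l where "l = ln (1 / lam)"
  have l: "0 < l" using lam by (simp add: l_def)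
  define S where "S = {s \<in> {0<..}. Limsup (at_right 0)
     (\<lambda>\<epsilon>. ereal (real (cover_num (HC M) (HC_dist d (\<lambda>n. lam ^ n)) (HC M) \<epsilon>) * fine_gauge s \<epsilon>)) < \<infinity>}"
  have Mcrit: "upper_Minkowski_crit (HC M) (HC_dist d (\<lambda>n. lam ^ n)) fine_scale (HC M)
      = (if S = {} then Sup (ereal ` {0<..}) else Inf (ereal ` S))"
    unfolding upper_Minkowski_crit_def fine_scale_eq S_def Let_def fst_conv snd_conv by (rule refl)
  have nonneg: "0 \<le> upper_Minkowski_dim M d M"
  proof -
    have "0 \<le> ln (real (cover_num M d M \<epsilon>)) / ln (1 / \<epsilon>)" if "0 < \<epsilon>" "\<epsilon> < 1" for \<epsilon>
      using that by (cases "cover_num M d M \<epsilon> = 0") auto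
    then have "\<forall>\<^sub>F \<epsilon> in at_right 0. 0 \<le> ereal (ln (real (cover_num M d M \<epsilon>)) / ln (1 / \<epsilon>))"
      by (intro eventually_at_rightI[of 0 1]) auto
    then show ?thesis unfolding upper_Minkowski_dim_def by (intro le_Limsup) auto
  qed
  assume "\<not> ?thesis"
  then have "upper_Minkowski_dim M d M / ereal (2 * l)
      < upper_Minkowski_crit (HC M) (HC_dist d (\<lambda>n. lam ^ n)) fine_scale (HC M)"
    by (simp only: l_def not_le)
  then obtain u where u: "upper_Minkowski_dim M d M / ereal (2 * l) < ereal u"
     "ereal u < upper_Minkowski_crit (HC M) (HC_dist d (\<lambda>n. lam ^ n)) fine_scale (HC M)"
    using ereal_dense2 by blast
  have "upper_Minkowski_dim M d M < ereal (2 * l) * ereal u"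
    using u(1) l by (subst (asm) ereal_divide_less_pos) auto
  then obtain t where t: "upper_Minkowski_dim M d M < ereal t" "ereal t < ereal (2 * l * u)"
    using ereal_dense2[of "upper_Minkowski_dim M d M" "ereal (2 * l * u)"] by auto
  have "0 < t" using le_less_trans[OF nonneg t(1)] by simp
  have "t < 2 * l * u" using t by simp
  then have "0 < 2 * l * u" using \<open>0 < t\<close> by linarith
  then have "0 < u" using l by (simp add: zero_less_mult_iff)
  have "t / (2 * l) < u" using \<open>t < _\<close> l by (simp add: field_simps)
  then have "u \<in> S" unfolding S_def
    using HC_cover_num_fine_bounded[OF cs lam t(1) \<open>0 < t\<close>, of u] \<open>0 < u\<close> by (simp add: l_def)
  then have "upper_Minkowski_crit (HC M) (HC_dist d (\<lambda>n. lam ^ n)) fine_scale (HC M) \<le> ereal u"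
    unfolding Mcrit by (auto intro: Inf_lower)
  then show False using u(2) by simp
qed

end

theorem proposition4p2:
  fixes X :: "'a set" and d :: "'a \<Rightarrow> 'a \<Rightarrow> real" and lam :: real
  assumes "Metric_space X d"
    and "compact_space (Metric_space.mtopology X d)"
    and "0 < lam" and "lam < 1"
  shows "let H = HC X; \<rho> = HC_dist d (\<lambda>n. lam ^ n) in
      Hausdorff_dim X d X / ereal (2 * ln (1 / lam)) \<le> crit H \<rho> fine_scale H \<and>
      crit H \<rho> fine_scale H \<le> upper_Minkowski_crit H \<rho> fine_scale H \<and>
      upper_Minkowski_crit H \<rho> fine_scale H
        \<le> upper_Minkowski_dim X d X / ereal (2 * ln (1 / lam)) \<and>
      (0 < Hausdorff_dim X d X \<and> Hausdorff_dim X d X < \<infinity> \<and>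
       0 < upper_Minkowski_dim X d X \<and> upper_Minkowski_dim X d X < \<infinity> \<longrightarrow>
       crit H \<rho> coarse_scale H = 2)"
proof -
  interpret Metric_space X d by fact
  note cs = assms(2) and lam = assms(3,4)
  define \<rho> where "\<rho> = HC_dist d (\<lambda>n. lam ^ n)"
  define l where "l = ereal (2 * ln (1 / lam))"
  have l: "0 < l" "l \<noteq> \<infinity>" using lam by (auto simp: l_def)
  interpret H: Metric_space "HC X" \<rho>
    unfolding \<rho>_def by (rule Metric_space_HC_powers[OF cs lam])
  have "H.mtotally_bounded (HC X)"
    unfolding \<rho>_def by (rule HC_cover_num_le[OF cs lam])
  then have mid: "crit (HC X) \<rho> fine_scale (HC X) \<le> upper_Minkowski_crit (HC X) \<rho> fine_scale (HC X)"
    by (rule H.crit_le_upper_Minkowski_crit_fine)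
  have low: "Hausdorff_dim X d X / l \<le> crit (HC X) \<rho> fine_scale (HC X)"
    unfolding \<rho>_def l_def by (rule crit_fine_HC_ge[OF cs lam])
  have up: "upper_Minkowski_crit (HC X) \<rho> fine_scale (HC X) \<le> upper_Minkowski_dim X d X / l"
    unfolding \<rho>_def l_def by (rule upper_Minkowski_crit_fine_HC_le[OF cs lam])
  have "crit (HC X) \<rho> coarse_scale (HC X) = 2"
    if "0 < Hausdorff_dim X d X" "upper_Minkowski_dim X d X < \<infinity>"
  proof (rule crit_eq_2_coarse)
    have "0 < Hausdorff_dim X d X / l" using that(1) l by (simp add: ereal_less_divide_pos)
    then show "0 < crit (HC X) \<rho> fine_scale (HC X)" using low by (rule less_le_trans)
    have "upper_Minkowski_dim X d X / l < \<infinity>" unfolding ereal_divide_less_pos[OF l] using that(2) l by (cases l) auto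
    then show "crit (HC X) \<rho> fine_scale (HC X) < \<infinity>"
      by (rule le_less_trans[OF order_trans[OF mid up]])
  qed
  then show ?thesis using low mid up unfolding Let_def \<rho>_def l_def by blast
qed

end
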